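(* Let $\mathbb{F}$ be a field of characteristic not equal to $2$. Suppose that $A$ is a primitive axial algebra over $\mathbb{F}$ generated by two elements $p,q$ such that $p$ is a primitive $\mathcal{M}(\alpha,\beta)$-axis and $q$ is a primitive $\mathcal{J}(\alpha)$-axis. Then $A$ is isomorphic to one of the following: 1. an axial algebra of $\mathcal{J}(\alpha)$-type; or 2. one of the following algebras: (a) $3\mathrm{C}(\alpha,1-\alpha)$, with $\alpha\neq\frac12$ and $\alpha+\beta=1$; (b) $Q_2(\frac13,\frac23)$, with $(\alpha,\beta)=(\frac13,\frac23)$ and $\mathbb{F}$ of characteristic not equal to $5$; (c) $Q_2(\frac13)^\times\oplus\langle\mathbf{1}\rangle$, with $(\alpha,\beta)=(\frac13,\frac23)$ and $\mathbb{F}$ of characteristic equal to $5$.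
   Context: Algebras are commutative but not necessarily associative. For $a\in A$ and $\lambda\in\mathbb{F}$, let $A_\lambda(a)=\{x\in A: ax=\lambda x\}$; for $S\subseteq\mathbb{F}$ put $A_S(a)=\bigoplus_{\lambda\in S}A_\lambda(a)$ (so $A_\emptyset(a)=0$). A (symmetric) fusion law is a set $\mathcal{F}\subseteq\mathbb{F}$ with a symmetric map $\star:\mathcal{F}\times\mathcal{F}\to 2^{\mathcal{F}}$. For $\eta\in\mathbb{F}\setminus\{0,1\}$, $\mathcal{J}(\eta)$ is the fusion law on $\{0,1,\eta\}$ with $1\star1=\{1\}$, $0\star0=\{0\}$, $1\star0=\emptyset$, $1\star\eta=0\star\eta=\{\eta\}$, $\eta\star\eta=\{1,0\}$. For $\alpha,\beta\in\mathbb{F}\setminus\{0,1\}$ distinct, $\mathcal{M}(\alpha,\beta)$ is the fusion law on $\{0,1,\alpha,\beta\}$ with $1\star1=\{1\}$, $0\star0=\{0\}$, $1\star0=\emptyset$, $1\star\alpha=0\star\alpha=\{\alpha\}$, $1\star\beta=0\star\beta=\{\beta\}$, $\alpha\star\alpha=\{1,0\}$, $\alpha\star\beta=\{\beta\}$, $\beta\star\beta=\{1,0,\alpha\}$. A (primitive) $\mathcal{F}$-axis is an element $a\in A$ with $a^2=a$, $A=A_{\mathcal{F}}(a)$, $A_\lambda(a)A_\mu(a)\subseteq A_{\lambda\star\mu}(a)$ for all $\lambda,\mu\in\mathcal{F}$, and $A_1(a)=\mathbb{F}a$. A primitive $\mathcal{F}$-axial algebra is an algebra generated by a set $X$ of primitive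 $\mathcal{F}$-axes; throughout $|X|=2$ (here $X=\{p,q\}$, $p\ne q$). An axial algebra of $\mathcal{J}(\alpha)$-type is a primitive $\mathcal{J}(\alpha)$-axial algebra. The algebras ($\cong$ denotes isomorphism of algebras; the second parameters record the fusion law under consideration): - $3\mathrm{C}(\eta)$, $\eta\notin\{0,1\}$: basis $x,y,z$, all idempotent, with $xy=\frac{\eta}{2}(x+y-z)$, $xz=\frac{\eta}{2}(x+z-y)$, $yz=\frac{\eta}{2}(y+z-x)$. For $\alpha\notin\{0,1,\frac12,-1\}$, $3\mathrm{C}(\alpha,1-\alpha)$ is $3\mathrm{C}(\alpha)$ regarded with fusion law $\mathcal{M}(\alpha,1-\alpha)$ (generated by the axes $\mathbf{1}-x$ and $y$, where $\mathbf{1}=\frac{1}{\alpha+1}(x+y+z)$ is the identity). For $\alpha=-1$, $3\mathrm{C}(-1,2)$ is the algebra $3\mathrm{C}(2)$ regarded with fusion law $\mathcal{M}(-1,2)$. - $Q_2(\frac13)$ (characteristic not $2,3$): basis $s_1,s_2,d_1,d_2$, all idempotent, with $s_1s_2=0$, and for $i=1,2$: $s_id_1=\frac13s_i+\frac16d_1-\frac16d_2$, $s_id_2=\frac13s_i-\frac16d_1+\frac16d_2$; and $d_1d_2=-\frac13s_1-\frac13s_2+\frac13d_1+\frac13d_2$. In characteristic not $5$ it has identity $\mathbf{1}=\frac35(s_1+s_2+d_1+d_2)$, and $Q_2(\frac13,\frac23)$ denotes this algebra regarded with fusion law $\mathcal{M}(\frac13,\frac23)$ (generated by the axes $s_1$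 and $\mathbf{1}-d_1$). - $Q_2(\frac13)^\times\oplus\langle\mathbf{1}\rangle$ (characteristic $5$): basis $x,y,z,\mathbf{1}$ with $\mathbf{1}$ an identity element, $x,y,z$ idempotent, $xy=0$, $xz=3x+y+2z$, $yz=x+3y+2z$. *)

theory Defs
  imports "HOL-Analysis.Cartesian_Space"
begin

section \<open>Fusion laws\<close>

record 'f fusion_law =
  law_carrier :: "'f set"
  law_star :: "'f \<Rightarrow> 'f \<Rightarrow> 'f set"

definition is_fusion_law :: "'f fusion_law \<Rightarrow> bool" where
  "is_fusion_law \<F> \<longleftrightarrow>
     (\<forall>l\<in>law_carrier \<F>. \<forall>m\<in>law_carrier \<F>.
        law_star \<F> l m \<subseteq> law_carrier \<F> \<and> law_star \<F> l m = law_star \<F> m l)"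

text \<open>
  The cases are given by the unordered pair \<open>{l, m}\<close>, a singleton on the diagonal. The last line
  covers the pair \<open>{0, 1}\<close>, with empty product; the values for arguments outside the carrier
  are irrelevant.
\<close>

definition J_law :: "'f::field \<Rightarrow> 'f fusion_law" where
  "J_law \<eta> = \<lparr>law_carrier = {0, 1, \<eta>},
     law_star = (\<lambda>l m.
       if {l, m} = {1} then {1}
       else if {l, m} = {0} then {0}
       else if {l, m} \<in> {{1, \<eta>}, {0, \<eta>}} then {\<eta>}
       else if {l, m} = {\<eta>} then {1, 0}
       else {})\<rparr>"

definition M_law :: "'f::field \<Rightarrow> 'f \<Rightarrow> 'f fusion_law" where
  "M_law \<alpha> \<beta> = \<lparr>law_carrier = {0, 1, \<alpha>, \<beta>},
     law_star = (\<lambda>l m.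
       if {l, m} = {1} then {1}
       else if {l, m} = {0} then {0}
       else if {l, m} \<in> {{1, \<alpha>}, {0, \<alpha>}} then {\<alpha>}
       else if {l, m} \<in> {{1, \<beta>}, {0, \<beta>}, {\<alpha>, \<beta>}} then {\<beta>}
       else if {l, m} = {\<alpha>} then {1, 0}
       else if {l, m} = {\<beta>} then {1, 0, \<alpha>}
       else {})\<rparr>"

lemma if_subset: "A \<subseteq> C \<Longrightarrow> B \<subseteq> C \<Longrightarrow> (if b then A else B) \<subseteq> C"
  by simp

lemma is_fusion_law_J_law: "is_fusion_law (J_law \<eta>)"
  unfolding is_fusion_law_def
proof (intro ballI conjI)
  fix l m
  show "law_star (J_law \<eta>) l m \<subseteq> law_carrier (J_law \<eta>)"
    unfolding J_law_def fusion_law.simps by (intro if_subset) simp_all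
  show "law_star (J_law \<eta>) l m = law_star (J_law \<eta>) m l"
    by (simp only: J_law_def fusion_law.simps insert_commute)
qed

lemma is_fusion_law_M_law: "is_fusion_law (M_law \<alpha> \<beta>)"
  unfolding is_fusion_law_def
proof (intro ballI conjI)
  fix l m
  show "law_star (M_law \<alpha> \<beta>) l m \<subseteq> law_carrier (M_law \<alpha> \<beta>)"
    unfolding M_law_def fusion_law.simps by (intro if_subset) simp_all
  show "law_star (M_law \<alpha> \<beta>) l m = law_star (M_law \<alpha> \<beta>) m l"
    by (simp only: M_law_def fusion_law.simps insert_commute)
qed


section \<open>Commutative, not necessarily associative algebras and their axes\<close>

locale comm_algebra = vector_space scale
  for scale :: "'f::field \<Rightarrow> 'a::ab_group_add \<Rightarrow> 'a" +
  fixes mul :: "'a \<Rightarrow> 'a \<Rightarrow> 'a"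
  assumes mul_comm: "mul x y = mul y x"
    and mul_add_left: "mul (x + y) z = mul x z + mul y z"
    and mul_scale_left: "mul (scale c x) y = scale c (mul x y)"
begin

definition eigenspace :: "'a \<Rightarrow> 'f \<Rightarrow> 'a set" where
  "eigenspace a l = {x. mul a x = scale l x}"

text \<open>
  The sum of the eigenspaces; eigenspaces for distinct eigenvalues are independent, so this sum
  is automatically direct. It is \<open>{0}\<close> for the empty set.
\<close>
definition eigenspaces :: "'a \<Rightarrow> 'f set \<Rightarrow> 'a set" where
  "eigenspaces a S = span (\<Union>l\<in>S. eigenspace a l)"

definition primitive_axis :: "'f fusion_law \<Rightarrow> 'a \<Rightarrow> bool" where
  "primitive_axis \<F> a \<longleftrightarrow>
     mul a a = a \<and>
     eigenspaces a (law_carrier \<F>) = UNIV \<and>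
     (\<forall>l\<in>law_carrier \<F>. \<forall>m\<in>law_carrier \<F>. \<forall>x\<in>eigenspace a l. \<forall>y\<in>eigenspace a m.
        mul x y \<in> eigenspaces a (law_star \<F> l m)) \<and>
     eigenspace a 1 = span {a}"

definition subalgebra :: "'a set \<Rightarrow> bool" where
  "subalgebra S \<longleftrightarrow> subspace S \<and> (\<forall>x\<in>S. \<forall>y\<in>S. mul x y \<in> S)"

definition generates :: "'a set \<Rightarrow> bool" where
  "generates X \<longleftrightarrow> subalgebra hull X = UNIV"

text \<open>Axial algebras are 2-generated throughout.\<close>
definition primitive_axial_algebra :: "'f fusion_law \<Rightarrow> bool" where
  "primitive_axial_algebra \<F> \<longleftrightarrow>
     (\<exists>X. card X = 2 \<and> (\<forall>a\<in>X. primitive_axis \<F> a) \<and> generates X)"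

definition axial_algebra_of_J_type :: "'f \<Rightarrow> bool" where
  "axial_algebra_of_J_type \<eta> \<longleftrightarrow> \<eta> \<notin> {0, 1} \<and> primitive_axial_algebra (J_law \<eta>)"

end

definition algebra_isomorphic ::
  "('f::field \<Rightarrow> 'a::ab_group_add \<Rightarrow> 'a) \<Rightarrow> ('a \<Rightarrow> 'a \<Rightarrow> 'a) \<Rightarrow>
   ('f \<Rightarrow> 'b::ab_group_add \<Rightarrow> 'b) \<Rightarrow> ('b \<Rightarrow> 'b \<Rightarrow> 'b) \<Rightarrow> bool" where
  "algebra_isomorphic scale1 mul1 scale2 mul2 \<longleftrightarrow>
     (\<exists>f. Vector_Spaces.linear scale1 scale2 f \<and> bij f \<and>
          (\<forall>x y. f (mul1 x y) = mul2 (f x) (f y)))"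


section \<open>The concrete algebras\<close>

text \<open>
  An algebra with a given finite basis is modelled on coordinate vectors indexed by a type of
  basis labels, with scalar multiplication \<open>*s\<close>. The multiplications are the commutative
  bilinear extensions of the products of basis vectors. Here \<open>bvec i\<close> is the
  basis vector with label \<open>i\<close> (the library's \<open>axis i 1\<close>, which has nothing to do with axes of
  algebras), and \<open>cross i j u v\<close> is the coefficient of the product of the basis vectors
  \<open>i\<close> and \<open>j\<close>, for distinct \<open>i\<close> and \<open>j\<close>, in the product of \<open>u\<close> and \<open>v\<close>.
\<close>

abbreviation bvec :: "'n \<Rightarrow> 'f::field ^ 'n" where
  "bvec i \<equiv> axis i 1"

definition cross :: "'n \<Rightarrow> 'n \<Rightarrow> 'f::field ^ 'n \<Rightarrow> 'f ^ 'n \<Rightarrow> 'f" where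
  "cross i j u v = u $ i * v $ j + u $ j * v $ i"

lemma bvec_nth: "bvec k $ i = (if i = k then 1 else 0)"
  by (simp add: axis_def)

lemma comm_algebra_add:
  assumes "comm_algebra (*s) (f :: 'f::field ^ 'n \<Rightarrow> _)" and "comm_algebra (*s) g"
  shows "comm_algebra (*s) (\<lambda>u v. f u v + g u v)"
proof -
  interpret F: comm_algebra "(*s)" f by fact
  interpret G: comm_algebra "(*s)" g by fact
  show ?thesis
  proof unfold_locales
    show "f x y + g x y = f y x + g y x" for x y
      by (metis F.mul_comm G.mul_comm)
  qed (simp_all add: F.mul_add_left G.mul_add_left F.mul_scale_left G.mul_scale_left
         vec.scale_right_distrib)
qed

lemma comm_algebra_diag: "comm_algebra (*s) (\<lambda>u v. (u $ i * v $ i) *s (w :: 'f::field ^ 'n))"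
  by unfold_locales (auto simp: vec_eq_iff algebra_simps)

lemma comm_algebra_cross: "comm_algebra (*s) (\<lambda>u v. cross i j u v *s (w :: 'f::field ^ 'n))"
  by unfold_locales (auto simp: vec_eq_iff cross_def algebra_simps)


subsection \<open>The algebras 3C\<close>

datatype basis3 = X3 | Y3 | Z3

instance basis3 :: finite
proof
  have univ: "(UNIV :: basis3 set) = {X3, Y3, Z3}"
    using basis3.exhaust by auto
  show "finite (UNIV :: basis3 set)"
    unfolding univ by simp
qed

definition threeC_mult :: "'f::field \<Rightarrow> 'f ^ basis3 \<Rightarrow> 'f ^ basis3 \<Rightarrow> 'f ^ basis3" where
  "threeC_mult \<eta> u v =
     (u $ X3 * v $ X3) *s bvec X3 + (u $ Y3 * v $ Y3) *s bvec Y3 + (u $ Z3 * v $ Z3) *s bvec Z3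
   + cross X3 Y3 u v *s ((\<eta> / 2) *s (bvec X3 + bvec Y3 - bvec Z3))
   + cross X3 Z3 u v *s ((\<eta> / 2) *s (bvec X3 + bvec Z3 - bvec Y3))
   + cross Y3 Z3 u v *s ((\<eta> / 2) *s (bvec Y3 + bvec Z3 - bvec X3))"

text \<open>
  The algebra underlying \<open>3C(\<alpha>, 1 - \<alpha>)\<close>. The fusion law under which it is regarded does not
  affect algebra isomorphism.
\<close>
definition threeC_M_mult :: "'f::field \<Rightarrow> 'f ^ basis3 \<Rightarrow> 'f ^ basis3 \<Rightarrow> 'f ^ basis3" where
  "threeC_M_mult \<alpha> = (if \<alpha> = -1 then threeC_mult 2 else threeC_mult \<alpha>)"

lemma threeC_basis_products:
  "threeC_mult \<eta> (bvec X3) (bvec X3) = bvec X3"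
  "threeC_mult \<eta> (bvec Y3) (bvec Y3) = bvec Y3"
  "threeC_mult \<eta> (bvec Z3) (bvec Z3) = bvec Z3"
  "threeC_mult \<eta> (bvec X3) (bvec Y3) = (\<eta> / 2) *s (bvec X3 + bvec Y3 - bvec Z3)"
  "threeC_mult \<eta> (bvec X3) (bvec Z3) = (\<eta> / 2) *s (bvec X3 + bvec Z3 - bvec Y3)"
  "threeC_mult \<eta> (bvec Y3) (bvec Z3) = (\<eta> / 2) *s (bvec Y3 + bvec Z3 - bvec X3)"
  by (simp_all add: threeC_mult_def cross_def bvec_nth)

lemma comm_algebra_threeC: "comm_algebra (*s) (threeC_mult \<eta>)"
  unfolding threeC_mult_def[abs_def] by (intro comm_algebra_add comm_algebra_diag comm_algebra_cross)


subsection \<open>The algebra \<open>Q\<^sub>2(1/3)\<close>\<close>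

datatype basisQ = S1 | S2 | D1 | D2

instance basisQ :: finite
proof
  have univ: "(UNIV :: basisQ set) = {S1, S2, D1, D2}"
    using basisQ.exhaust by auto
  show "finite (UNIV :: basisQ set)"
    unfolding univ by simp
qed

text \<open>Meaningful only in characteristic other than 2 and 3, because of the denominators.\<close>
definition Q2_mult :: "'f::field ^ basisQ \<Rightarrow> 'f ^ basisQ \<Rightarrow> 'f ^ basisQ" where
  "Q2_mult u v =
     (u $ S1 * v $ S1) *s bvec S1 + (u $ S2 * v $ S2) *s bvec S2
   + (u $ D1 * v $ D1) *s bvec D1 + (u $ D2 * v $ D2) *s bvec D2
   + cross S1 S2 u v *s 0
   + cross S1 D1 u v *s ((1/3) *s bvec S1 + (1/6) *s bvec D1 - (1/6) *s bvec D2)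
   + cross S2 D1 u v *s ((1/3) *s bvec S2 + (1/6) *s bvec D1 - (1/6) *s bvec D2)
   + cross S1 D2 u v *s ((1/3) *s bvec S1 - (1/6) *s bvec D1 + (1/6) *s bvec D2)
   + cross S2 D2 u v *s ((1/3) *s bvec S2 - (1/6) *s bvec D1 + (1/6) *s bvec D2)
   + cross D1 D2 u v *s
       (- (1/3) *s bvec S1 - (1/3) *s bvec S2 + (1/3) *s bvec D1 + (1/3) *s bvec D2)"

lemma Q2_basis_products:
  "Q2_mult (bvec S1) (bvec S1) = bvec S1"
  "Q2_mult (bvec S2) (bvec S2) = bvec S2"
  "Q2_mult (bvec D1) (bvec D1) = bvec D1"
  "Q2_mult (bvec D2) (bvec D2) = bvec D2"
  "Q2_mult (bvec S1) (bvec S2) = 0"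
  "Q2_mult (bvec S1) (bvec D1) = (1/3) *s bvec S1 + (1/6) *s bvec D1 - (1/6) *s bvec D2"
  "Q2_mult (bvec S2) (bvec D1) = (1/3) *s bvec S2 + (1/6) *s bvec D1 - (1/6) *s bvec D2"
  "Q2_mult (bvec S1) (bvec D2) = (1/3) *s bvec S1 - (1/6) *s bvec D1 + (1/6) *s bvec D2"
  "Q2_mult (bvec S2) (bvec D2) = (1/3) *s bvec S2 - (1/6) *s bvec D1 + (1/6) *s bvec D2"
  "Q2_mult (bvec D1) (bvec D2) =
     - (1/3) *s bvec S1 - (1/3) *s bvec S2 + (1/3) *s bvec D1 + (1/3) *s bvec D2"
  by (simp_all add: Q2_mult_def cross_def bvec_nth)

lemma comm_algebra_Q2: "comm_algebra (*s) Q2_mult"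
  unfolding Q2_mult_def[abs_def] by (intro comm_algebra_add comm_algebra_diag comm_algebra_cross)


subsection \<open>The algebra \<open>Q\<^sub>2(1/3)\<^sup>\<times> \<oplus> \<langle>1\<rangle>\<close>\<close>

datatype basisQx = X4 | Y4 | Z4 | One4

instance basisQx :: finite
proof
  have univ: "(UNIV :: basisQx set) = {X4, Y4, Z4, One4}"
    using basisQx.exhaust by auto
  show "finite (UNIV :: basisQx set)"
    unfolding univ by simp
qed

text \<open>Used only in characteristic 5.\<close>
definition Q2x_mult :: "'f::field ^ basisQx \<Rightarrow> 'f ^ basisQx \<Rightarrow> 'f ^ basisQx" where
  "Q2x_mult u v =
     (u $ X4 * v $ X4) *s bvec X4 + (u $ Y4 * v $ Y4) *s bvec Y4
   + (u $ Z4 * v $ Z4) *s bvec Z4 + (u $ One4 * v $ One4) *s bvec One4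
   + cross X4 One4 u v *s bvec X4 + cross Y4 One4 u v *s bvec Y4 + cross Z4 One4 u v *s bvec Z4
   + cross X4 Y4 u v *s 0
   + cross X4 Z4 u v *s (3 *s bvec X4 + bvec Y4 + 2 *s bvec Z4)
   + cross Y4 Z4 u v *s (bvec X4 + 3 *s bvec Y4 + 2 *s bvec Z4)"

lemma Q2x_basis_products:
  "Q2x_mult (bvec X4) (bvec X4) = bvec X4"
  "Q2x_mult (bvec Y4) (bvec Y4) = bvec Y4"
  "Q2x_mult (bvec Z4) (bvec Z4) = bvec Z4"
  "Q2x_mult (bvec One4) u = u"
  "Q2x_mult (bvec X4) (bvec Y4) = 0"
  "Q2x_mult (bvec X4) (bvec Z4) = 3 *s bvec X4 + bvec Y4 + 2 *s bvec Z4"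
  "Q2x_mult (bvec Y4) (bvec Z4) = bvec X4 + 3 *s bvec Y4 + 2 *s bvec Z4"
proof -
  have "Q2x_mult (bvec One4) u $ i = u $ i" for i
    by (cases i) (simp_all add: Q2x_mult_def cross_def axis_def)
  then show "Q2x_mult (bvec One4) u = u"
    by (simp add: vec_eq_iff)
qed (simp_all add: Q2x_mult_def cross_def bvec_nth)

lemma comm_algebra_Q2x: "comm_algebra (*s) Q2x_mult"
  unfolding Q2x_mult_def[abs_def] by (intro comm_algebra_add comm_algebra_diag comm_algebra_cross)

end

theory Submission
  imports Defs
begin

text \<open>
  Write \<open>q = \<mu>p + x + y + z\<close> with \<open>x\<close>, \<open>y\<close>, \<open>z\<close> in the \<open>0\<close>-, \<open>\<alpha>\<close>- and \<open>\<beta>\<close>-eigenspaces of \<open>p\<close>, and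
  \<open>p = \<kappa>q + u + v\<close> with \<open>u\<close>, \<open>v\<close> in the \<open>0\<close>- and \<open>\<alpha>\<close>-eigenspaces of \<open>q\<close>. If \<open>z = 0\<close>, then the
  \<open>\<beta>\<close>-eigenspace of \<open>p\<close> vanishes and \<open>p\<close> is itself a \<open>J(\<alpha>)\<close>-axis.

  The crucial point is that \<open>p, x, y, z\<close> span the algebra. The identity \<open>p \<odot> p = p\<close> shows
  that \<open>u \<odot> u\<close>, \<open>u \<odot> v\<close> and \<open>v \<odot> v\<close> lie in the span of \<open>q, u, v\<close> and a single new vector \<open>w\<close> in the
  \<open>0\<close>-eigenspace of \<open>q\<close>. This span equals that of \<open>p, x, y, z\<close>, so it is invariant under
  multiplication by both axes, and this forces the remaining products into it.

  Hence multiplication by \<open>q\<close> has rank at most \<open>2\<close>. This and the fusion law of \<open>q\<close> give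
  polynomial equations for the structure constants in \<open>p, x, y, z\<close>. If \<open>z \<noteq> 0\<close>, they force \<open>x \<noteq> 0\<close>
  and have a unique solution: with \<open>\<alpha> + \<beta> = 1\<close> if \<open>y = 0\<close>, and with \<open>\<alpha> = 1/3\<close>, \<open>\<beta> = 2/3\<close> if
  \<open>y \<noteq> 0\<close>. In these solutions the bases of the listed algebras can be written down.
\<close>

section \<open>Axes and their eigenvectors\<close>

context comm_algebra
begin

section \<open>Bilinear arithmetic and sums of eigenspaces\<close>

lemma mul_add_right: "mul x (y + z) = mul x y + mul x z"
  by (metis mul_comm mul_add_left)

lemma mul_scale_right: "mul x (scale c y) = scale c (mul x y)"
  by (metis mul_comm mul_scale_left)

lemma mul_zero_left [simp]: "mul 0 x = 0"
  using mul_scale_left[of 0 0 x] by simp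

lemma mul_zero_right [simp]: "mul x 0 = 0"
  by (metis mul_comm mul_zero_left)

lemma mul_minus_left: "mul (- x) y = - mul x y"
  using mul_scale_left[of "-1" x y] by simp

lemma mul_minus_right: "mul x (- y) = - mul x y"
  by (metis mul_comm mul_minus_left)

lemma mul_diff_left: "mul (x - y) z = mul x z - mul y z"
  using mul_add_left[of x "- y" z] by (simp add: mul_minus_left)

lemma mul_diff_right: "mul x (y - z) = mul x y - mul x z"
  by (metis mul_comm mul_diff_left)

lemmas bilinear_simps =
  mul_add_left mul_add_right mul_diff_left mul_diff_right mul_minus_left mul_minus_right
  mul_scale_left mul_scale_right

lemma subspace_eigenspace: "subspace (eigenspace a l)"
  by (rule subspaceI)
    (simp_all add: eigenspace_def bilinear_simps scale_right_distrib mult.commute)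

lemma eigenspaces_empty: "eigenspaces a {} = {0}"
  by (simp add: eigenspaces_def)

lemma eigenspaces_insert:
  "eigenspaces a (insert l S) = {x + y |x y. x \<in> eigenspace a l \<and> y \<in> eigenspaces a S}"
  by (simp add: eigenspaces_def span_Un span_eq_iff[THEN iffD2, OF subspace_eigenspace])

lemma eigenspaces_singleton: "eigenspaces a {l} = eigenspace a l"
  by (auto simp: eigenspaces_insert eigenspaces_empty)

text \<open>Unpacks the axis conditions into equations between eigenvectors. Primitivity turns the
  \<open>1\<close>-part of a decomposition into a multiple of \<open>p\<close>; each clause after
  the second is one entry of the fusion table.\<close>

lemma M_axis_facts:
  assumes "\<alpha> \<notin> {0, 1}" and "\<beta> \<notin> {0, 1}" and "\<alpha> \<noteq> \<beta>"
    and ax: "primitive_axis (M_law \<alpha> \<beta>) p"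
  shows "mul p p = p"
    and "\<exists>c x y z. e = scale c p + x + y + z \<and>
           mul p x = 0 \<and> mul p y = scale \<alpha> y \<and> mul p z = scale \<beta> z"
    and "mul p x = 0 \<Longrightarrow> mul p x' = 0 \<Longrightarrow> mul p (mul x x') = 0"
    and "mul p x = 0 \<Longrightarrow> mul p y = scale \<alpha> y \<Longrightarrow> mul p (mul x y) = scale \<alpha> (mul x y)"
    and "mul p x = 0 \<Longrightarrow> mul p z = scale \<beta> z \<Longrightarrow> mul p (mul x z) = scale \<beta> (mul x z)"
    and "mul p y = scale \<alpha> y \<Longrightarrow> mul p y' = scale \<alpha> y' \<Longrightarrow>
           \<exists>c x. mul y y' = scale c p + x \<and> mul p x = 0"
    and "mul p y = scale \<alpha> y \<Longrightarrow> mul p z = scale \<beta> z \<Longrightarrow>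
           mul p (mul y z) = scale \<beta> (mul y z)"
    and "mul p z = scale \<beta> z \<Longrightarrow> mul p z' = scale \<beta> z' \<Longrightarrow>
           \<exists>c x y. mul z z' = scale c p + x + y \<and> mul p x = 0 \<and> mul p y = scale \<alpha> y"
proof -
  note ax' = ax[unfolded primitive_axis_def]
  have carrier: "law_carrier (M_law \<alpha> \<beta>) = {0, 1, \<alpha>, \<beta>}"
    by (simp add: M_law_def)
  have E: "x \<in> eigenspace p l \<longleftrightarrow> mul p x = scale l x" for x l
    by (simp add: eigenspace_def)
  have E1: "x \<in> eigenspace p 1 \<longleftrightarrow> (\<exists>c. x = scale c p)" for x
    using ax' by (auto simp: span_singleton)
  have fus: "mul x y \<in> eigenspaces p (law_star (M_law \<alpha> \<beta>) l m)"
    if "l \<in> {0, 1, \<alpha>, \<beta>}" "m \<in> {0, 1, \<alpha>, \<beta>}" "mul p x = scale l x" "mul p y = scale m y" for l m x y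
    using ax' that unfolding E[symmetric] carrier by blast
  show "mul p p = p"
    using ax' by simp
  have "e \<in> eigenspaces p {1, 0, \<alpha>, \<beta>}"
    using ax' by (simp add: M_law_def insert_commute)
  then show "\<exists>c x y z. e = scale c p + x + y + z \<and>
           mul p x = 0 \<and> mul p y = scale \<alpha> y \<and> mul p z = scale \<beta> z"
    unfolding eigenspaces_insert eigenspaces_empty mem_Collect_eq E1
    by (fastforce simp: E add.assoc)
  \<comment> \<open>Evaluating \<open>law_star\<close> means comparing sets of at most two elements;
    that 0, 1, \<alpha>, \<beta> are distinct then selects the branch.\<close>
  note star = M_law_def doubleton_eq_iff eigenspaces_singleton E
  show "mul p (mul x x') = 0" if "mul p x = 0" "mul p x' = 0"
    using fus[of 0 0 x x'] that assms(1-3) by (simp add: star)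
  show "mul p (mul x y) = scale \<alpha> (mul x y)" if "mul p x = 0" "mul p y = scale \<alpha> y"
    using fus[of 0 \<alpha> x y] that assms(1-3) by (simp add: star)
  show "mul p (mul x z) = scale \<beta> (mul x z)" if "mul p x = 0" "mul p z = scale \<beta> z"
    using fus[of 0 \<beta> x z] that assms(1-3) by (simp add: star)
  show "mul p (mul y z) = scale \<beta> (mul y z)" if "mul p y = scale \<alpha> y" "mul p z = scale \<beta> z"
    using fus[of \<alpha> \<beta> y z] that assms(1-3) by (simp add: star)
  show "\<exists>c x. mul y y' = scale c p + x \<and> mul p x = 0"
    if "mul p y = scale \<alpha> y" "mul p y' = scale \<alpha> y'"
  proof -
    have "mul y y' \<in> eigenspaces p {1, 0}"
      using fus[of \<alpha> \<alpha> y y'] that assms(1-3) by (simp add: star)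
    then show ?thesis
      unfolding eigenspaces_insert eigenspaces_empty mem_Collect_eq E1 by (fastforce simp: E)
  qed
  show "\<exists>c x y. mul z z' = scale c p + x + y \<and> mul p x = 0 \<and> mul p y = scale \<alpha> y"
    if "mul p z = scale \<beta> z" "mul p z' = scale \<beta> z'"
  proof -
    have "mul z z' \<in> eigenspaces p {1, 0, \<alpha>}"
      using fus[of \<beta> \<beta> z z'] that assms(1-3) by (simp add: star)
    then show ?thesis
      unfolding eigenspaces_insert eigenspaces_empty mem_Collect_eq E1
      by (fastforce simp: E add.assoc)
  qed
qed

lemma J_axis_facts:
  assumes "\<alpha> \<notin> {0, 1}"
    and ax: "primitive_axis (J_law \<alpha>) q"
  shows "mul q q = q"
    and "\<exists>c u v. e = scale c q + u + v \<and> mul q u = 0 \<and> mul q v = scale \<alpha> v"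
    and "mul q u = 0 \<Longrightarrow> mul q u' = 0 \<Longrightarrow> mul q (mul u u') = 0"
    and "mul q u = 0 \<Longrightarrow> mul q v = scale \<alpha> v \<Longrightarrow> mul q (mul u v) = scale \<alpha> (mul u v)"
    and "mul q v = scale \<alpha> v \<Longrightarrow> mul q v' = scale \<alpha> v' \<Longrightarrow>
           \<exists>c u. mul v v' = scale c q + u \<and> mul q u = 0"
proof -
  note ax' = ax[unfolded primitive_axis_def]
  have carrier: "law_carrier (J_law \<alpha>) = {0, 1, \<alpha>}"
    by (simp add: J_law_def)
  have E: "x \<in> eigenspace q l \<longleftrightarrow> mul q x = scale l x" for x l
    by (simp add: eigenspace_def)
  have E1: "x \<in> eigenspace q 1 \<longleftrightarrow> (\<exists>c. x = scale c q)" for x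
    using ax' by (auto simp: span_singleton)
  have fus: "mul x y \<in> eigenspaces q (law_star (J_law \<alpha>) l m)"
    if "l \<in> {0, 1, \<alpha>}" "m \<in> {0, 1, \<alpha>}" "mul q x = scale l x" "mul q y = scale m y" for l m x y
    using ax' that unfolding E[symmetric] carrier by blast
  show "mul q q = q"
    using ax' by simp
  have "e \<in> eigenspaces q {1, 0, \<alpha>}"
    using ax' by (simp add: J_law_def insert_commute)
  then show "\<exists>c u v. e = scale c q + u + v \<and> mul q u = 0 \<and> mul q v = scale \<alpha> v"
    unfolding eigenspaces_insert eigenspaces_empty mem_Collect_eq E1
    by (fastforce simp: E add.assoc)
  note star = J_law_def doubleton_eq_iff eigenspaces_singleton E
  show "mul q (mul u u') = 0" if "mul q u = 0" "mul q u' = 0"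
    using fus[of 0 0 u u'] that assms(1) by (simp add: star)
  show "mul q (mul u v) = scale \<alpha> (mul u v)" if "mul q u = 0" "mul q v = scale \<alpha> v"
    using fus[of 0 \<alpha> u v] that assms(1) by (simp add: star)
  show "\<exists>c u. mul v v' = scale c q + u \<and> mul q u = 0"
    if "mul q v = scale \<alpha> v" "mul q v' = scale \<alpha> v'"
  proof -
    have "mul v v' \<in> eigenspaces q {1, 0}"
      using fus[of \<alpha> \<alpha> v v'] that assms(1) by (simp add: star)
    then show ?thesis
      unfolding eigenspaces_insert eigenspaces_empty mem_Collect_eq E1 by (fastforce simp: E)
  qed
qed

text \<open>Applying multiplication by \<open>a\<close> minus the last eigenvalue kills one summand
  and rescales the others by nonzero differences, so the number of summands drops one at a
  time.\<close>

lemma eigenvectors_independent: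
  assumes "distinct [l1, l2, l3, l4]"
    and e: "mul a x1 = scale l1 x1" "mul a x2 = scale l2 x2"
      "mul a x3 = scale l3 x3" "mul a x4 = scale l4 x4"
    and sum: "x1 + x2 + x3 + x4 = 0"
  shows "x1 = 0 \<and> x2 = 0 \<and> x3 = 0 \<and> x4 = 0"
proof -
  have two: "y1 = 0 \<and> y2 = 0"
    if "m1 \<noteq> m2" "mul a y1 = scale m1 y1" "mul a y2 = scale m2 y2" "y1 + y2 = 0" for m1 m2 y1 y2
  proof -
    have "mul a (y1 + y2) - scale m2 (y1 + y2) = scale (m1 - m2) y1"
      using that(2,3) by (simp add: bilinear_simps scale_right_distrib scale_left_diff_distrib)
    then show ?thesis
      using that by simp
  qed
  have three: "y1 = 0 \<and> y2 = 0 \<and> y3 = 0"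
    if "m1 \<noteq> m2" "m1 \<noteq> m3" "m2 \<noteq> m3" "mul a y1 = scale m1 y1" "mul a y2 = scale m2 y2"
      "mul a y3 = scale m3 y3" "y1 + y2 + y3 = 0" for m1 m2 m3 y1 y2 y3
  proof -
    have "mul a (y1 + y2 + y3) - scale m3 (y1 + y2 + y3) = scale (m1 - m3) y1 + scale (m2 - m3) y2"
      using that(4-6) by (simp add: bilinear_simps scale_right_distrib scale_left_diff_distrib)
    then have "scale (m1 - m3) y1 + scale (m2 - m3) y2 = 0"
      using that by simp
    then have "scale (m1 - m3) y1 = 0 \<and> scale (m2 - m3) y2 = 0"
      using that by (intro two[of m1 m2]) (simp_all add: bilinear_simps mult.commute)
    then show ?thesis
      using that by simp
  qed
  have "mul a (x1 + x2 + x3 + x4) - scale l4 (x1 + x2 + x3 + x4) =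
      scale (l1 - l4) x1 + scale (l2 - l4) x2 + scale (l3 - l4) x3"
    using e by (simp add: bilinear_simps scale_right_distrib scale_left_diff_distrib)
  then have "scale (l1 - l4) x1 + scale (l2 - l4) x2 + scale (l3 - l4) x3 = 0"
    using sum by simp
  then have "scale (l1 - l4) x1 = 0 \<and> scale (l2 - l4) x2 = 0 \<and> scale (l3 - l4) x3 = 0"
    using assms by (intro three[of l1 l2 l3]) (simp_all add: bilinear_simps mult.commute)
  then show ?thesis
    using assms by simp
qed

end

section \<open>The algebra is spanned by the components of the axes\<close>

locale axis_pair = comm_algebra scale mul
  for scale :: "'f::field \<Rightarrow> 'a::ab_group_add \<Rightarrow> 'a" (infixr "\<cdot>" 75)
    and mul :: "'a \<Rightarrow> 'a \<Rightarrow> 'a" (infixl "\<odot>" 77) +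
  fixes \<alpha> \<beta> :: 'f and p q :: 'a and \<mu> \<kappa> :: 'f and x y z u v :: 'a
  assumes two_nz: "(2::'f) \<noteq> 0"
    and \<alpha>_nz: "\<alpha> \<noteq> 0" and \<alpha>_n1: "\<alpha> \<noteq> 1" and \<beta>_nz: "\<beta> \<noteq> 0" and \<beta>_n1: "\<beta> \<noteq> 1"
    and \<alpha>_n\<beta>: "\<alpha> \<noteq> \<beta>"
    and axis_p: "primitive_axis (M_law \<alpha> \<beta>) p"
    and axis_q: "primitive_axis (J_law \<alpha>) q"
    and gen: "generates {p, q}"
    and q_eq: "q = \<mu> \<cdot> p + x + y + z"
    and px: "p \<odot> x = 0" and py: "p \<odot> y = \<alpha> \<cdot> y" and pz: "p \<odot> z = \<beta> \<cdot> z"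
    and p_eq: "p = \<kappa> \<cdot> q + u + v"
    and qu: "q \<odot> u = 0" and qv: "q \<odot> v = \<alpha> \<cdot> v"
begin

lemma pp: "p \<odot> p = p" and qq: "q \<odot> q = q"
  using M_axis_facts(1) J_axis_facts(1) axis_p axis_q \<alpha>_nz \<alpha>_n1 \<beta>_nz \<beta>_n1 \<alpha>_n\<beta> by blast+

text \<open>With idempotency split off, clause 1 is the decomposition and clauses 2 to 7 are the
  products 00, 0\<alpha>, 0\<beta>, \<alpha>\<alpha>, \<alpha>\<beta>, \<beta>\<beta>. In
  \<open>J_facts\<close>, clauses 2 to 4 are 00, 0\<alpha>, \<alpha>\<alpha>.\<close>

lemmas M_facts = M_axis_facts(2-)[of \<alpha> \<beta> p, simplified,
    OF conjI[OF \<alpha>_nz \<alpha>_n1] conjI[OF \<beta>_nz \<beta>_n1] \<alpha>_n\<beta> axis_p]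
lemmas J_facts = J_axis_facts(2-)[of \<alpha> q, simplified, OF conjI[OF \<alpha>_nz \<alpha>_n1] axis_q]

lemma p_independent:
  assumes "p \<odot> x0 = 0" "p \<odot> x1 = \<alpha> \<cdot> x1" "p \<odot> x2 = \<beta> \<cdot> x2" "c \<cdot> p + x0 + x1 + x2 = 0"
  shows "c \<cdot> p = 0 \<and> x0 = 0 \<and> x1 = 0 \<and> x2 = 0"
proof (rule eigenvectors_independent[of 1 0 \<alpha> \<beta> p])
  show "distinct [1, 0, \<alpha>, \<beta>]"
    using \<alpha>_nz \<alpha>_n1 \<beta>_nz \<beta>_n1 \<alpha>_n\<beta> by simp
qed (use assms pp in \<open>simp_all add: mul_scale_right\<close>)

lemma q_independent:
  assumes "q \<odot> x0 = 0" "q \<odot> x1 = \<alpha> \<cdot> x1" "c \<cdot> q + x0 + x1 = 0"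
  shows "c \<cdot> q = 0 \<and> x0 = 0 \<and> x1 = 0"
proof -
  \<comment> \<open>The zero vector serves as a fourth eigenvector, for \<beta>, to fit the
    four-term lemma.\<close>
  have "c \<cdot> q = 0 \<and> x0 = 0 \<and> x1 = 0 \<and> (0::'a) = 0"
    using assms qq \<alpha>_nz \<alpha>_n1 \<beta>_nz \<beta>_n1 \<alpha>_n\<beta>
    by (intro eigenvectors_independent[of 1 0 \<alpha> \<beta> q]) (auto simp: bilinear_simps)
  then show ?thesis
    by blast
qed

text \<open>The part of \<open>v \<odot> v\<close> in the \<open>0\<close>-eigenspace of
  \<open>q\<close>; the coefficient of \<open>q\<close> is the one that idempotency of
  \<open>p\<close> dictates.\<close>

definition w :: 'a where "w = v \<odot> v - (\<kappa> - \<kappa> * \<kappa>) \<cdot> q"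

lemma vv: "v \<odot> v = (\<kappa> - \<kappa> * \<kappa>) \<cdot> q + w"
  by (simp add: w_def)

text \<open>Expand \<open>p \<odot> p = p\<close> with
  \<open>p = \<kappa> \<cdot> q + u + v\<close>. The fusion law of \<open>q\<close> says where each
  product lies, so the \<open>q\<close>-, \<open>0\<close>- and \<alpha>-parts can be compared
  separately.\<close>

lemma qw: "q \<odot> w = 0" and uu: "u \<odot> u = u - w" and uv: "u \<odot> v = (1 / 2 - \<kappa> * \<alpha>) \<cdot> v"
proof -
  obtain c w' where w': "v \<odot> v = c \<cdot> q + w'" "q \<odot> w' = 0"
    using J_facts(4)[OF qv qv] by blast
  have q_uu: "q \<odot> (u \<odot> u) = 0" and q_uv: "q \<odot> (u \<odot> v) = \<alpha> \<cdot> (u \<odot> v)"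
    using J_facts(2)[OF qu qu] J_facts(3)[OF qu qv] by simp_all
  have "p \<odot> p = (\<kappa> * \<kappa>) \<cdot> q + u \<odot> u + v \<odot> v + (2 * \<kappa> * \<alpha>) \<cdot> v + 2 \<cdot> (u \<odot> v)"
    unfolding p_eq
    using scale_left_distrib[of 1 1 "u \<odot> v"] scale_left_distrib[of "\<kappa> * \<alpha>" "\<kappa> * \<alpha>" "v"]
    by (simp add: bilinear_simps qq qu qv mul_comm[of u q] mul_comm[of v q] mul_comm[of v u]
        algebra_simps)
  then have "(\<kappa> * \<kappa> + c - \<kappa>) \<cdot> q + (u \<odot> u + w' - u) + ((2 * \<kappa> * \<alpha> - 1) \<cdot> v + 2 \<cdot> (u \<odot> v)) = 0"
    using pp w'(1) p_eq by (simp add: algebra_simps)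
  then have *: "(\<kappa> * \<kappa> + c - \<kappa>) \<cdot> q = 0 \<and> u \<odot> u + w' - u = 0 \<and> (2 * \<kappa> * \<alpha> - 1) \<cdot> v + 2 \<cdot> (u \<odot> v) = 0"
    by (intro q_independent)
      (simp_all add: bilinear_simps qu qv q_uu q_uv w'(2) scale_right_distrib mult.commute)
  have "w = w'"
    using * w'(1) by (simp add: w_def algebra_simps)
  then show "q \<odot> w = 0" "u \<odot> u = u - w"
    using * w' by (simp_all add: algebra_simps)
  have "(1 / 2) \<cdot> ((2 * \<kappa> * \<alpha> - 1) \<cdot> v + 2 \<cdot> (u \<odot> v)) = 0"
    using * by simp
  then have "(\<kappa> * \<alpha> - 1 / 2) \<cdot> v + u \<odot> v = 0"
    using two_nz by (simp add: scale_right_distrib diff_divide_distrib right_diff_distrib)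
  moreover have "u \<odot> v = ((\<kappa> * \<alpha> - 1 / 2) \<cdot> v + u \<odot> v) + (1 / 2 - \<kappa> * \<alpha>) \<cdot> v"
    by (simp add: scale_left_diff_distrib)
  ultimately show "u \<odot> v = (1 / 2 - \<kappa> * \<alpha>) \<cdot> v"
    by simp
qed

section \<open>Two descriptions of \<open>q \<odot> p\<close>, and the span of
  \<open>q, u, v, w\<close>\<close>

lemma qp: "q \<odot> p = \<kappa> \<cdot> q + \<alpha> \<cdot> v"
  by (subst p_eq) (simp add: bilinear_simps qq qu qv)

lemma qp': "q \<odot> p = \<mu> \<cdot> p + \<alpha> \<cdot> y + \<beta> \<cdot> z"
  by (subst q_eq) (simp add: bilinear_simps pp px py pz mul_comm[of x p] mul_comm[of y p] mul_comm[of z p])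

lemma q_qp: "q \<odot> (q \<odot> p) = \<alpha> \<cdot> (q \<odot> p) + ((1 - \<alpha>) * \<kappa>) \<cdot> q"
  by (simp add: qp bilinear_simps qq qv scale_right_distrib scale_left_diff_distrib algebra_simps)

lemma pv: "p \<odot> v = (1 / 2) \<cdot> v + (\<kappa> - \<kappa> * \<kappa>) \<cdot> q + w"
  by (subst p_eq) (simp add: bilinear_simps qv uv vv algebra_simps)

abbreviation W :: "'a set" where "W \<equiv> span {q, u, v, w}"
abbreviation W0 :: "'a set" where "W0 \<equiv> span {q, u, v}"

lemma W_gens: "q \<in> W" "u \<in> W" "v \<in> W" "w \<in> W"
  by (simp_all add: span_base)

lemma W0_subset: "W0 \<subseteq> W"
  by (rule span_mono) auto

text \<open>Multiplying \<open>\<kappa> \<cdot> q + \<alpha> \<cdot> v\<close> by \<open>p\<close>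
  produces \<open>w\<close> only through \<open>p \<odot> v\<close>, with coefficient
  \<alpha>.\<close>

lemma p_pq: "p \<odot> (q \<odot> p) - \<alpha> \<cdot> w \<in> W0"
proof -
  have "p \<odot> (q \<odot> p) - \<alpha> \<cdot> w =
    \<kappa> \<cdot> (\<kappa> \<cdot> q + \<alpha> \<cdot> v) + \<alpha> \<cdot> ((1 / 2) \<cdot> v + (\<kappa> - \<kappa> * \<kappa>) \<cdot> q)"
    by (simp add: qp bilinear_simps pv scale_right_distrib mul_comm[of p q] del: scale_scale)
  then show ?thesis
    by (simp add: span_add span_scale span_base)
qed

lemma p_pq': "p \<odot> (q \<odot> p) = \<mu> \<cdot> p + (\<alpha> * \<alpha>) \<cdot> y + (\<beta> * \<beta>) \<cdot> z"
  by (simp add: qp' bilinear_simps pp py pz)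

lemma p_in_W0: "p \<in> W0" and qp_in_W0: "q \<odot> p \<in> W0"
  by (subst p_eq, simp add: span_add span_scale span_base)
    (simp add: qp span_add span_scale span_base)

text \<open>Both \<open>q \<odot> p\<close> and \<open>p \<odot> (q \<odot> p)\<close> are known in
  terms of \<open>p, y, z\<close> and modulo \<open>W0\<close>. Cancelling \<open>z\<close> leaves
  \<open>y\<close>, cancelling \<open>y\<close> leaves \<open>z\<close>, and \<open>q_eq\<close>
  then gives \<open>x\<close>: modulo \<open>W0\<close> all three are nonzero multiples of
  \<open>w\<close>.\<close>

lemma y_mod_W0: "(\<beta> - \<alpha>) \<cdot> y + w \<in> W0"
proof -
  have "\<beta> \<cdot> (q \<odot> p) - p \<odot> (q \<odot> p) + (\<mu> * (1 - \<beta>)) \<cdot> p = \<alpha> \<cdot> ((\<beta> - \<alpha>) \<cdot> y)"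
    unfolding p_pq' unfolding qp' by (simp add: algebra_simps)
  then have "\<alpha> \<cdot> ((\<beta> - \<alpha>) \<cdot> y + w) =
      \<beta> \<cdot> (q \<odot> p) - (p \<odot> (q \<odot> p) - \<alpha> \<cdot> w) + (\<mu> * (1 - \<beta>)) \<cdot> p"
    by (simp add: algebra_simps)
  also have "\<dots> \<in> W0"
    by (intro span_add span_diff span_scale p_pq p_in_W0 qp_in_W0)
  finally have "(1 / \<alpha>) \<cdot> (\<alpha> \<cdot> ((\<beta> - \<alpha>) \<cdot> y + w)) \<in> W0"
    by (rule span_scale)
  then show ?thesis
    using \<alpha>_nz by simp
qed

lemma z_mod_W0: "(\<beta> * (\<beta> - \<alpha>)) \<cdot> z - \<alpha> \<cdot> w \<in> W0"
proof -
  have "p \<odot> (q \<odot> p) - \<alpha> \<cdot> (q \<odot> p) - (\<mu> * (1 - \<alpha>)) \<cdot> p = (\<beta> * (\<beta> - \<alpha>)) \<cdot> z"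
    unfolding p_pq' unfolding qp' by (simp add: algebra_simps)
  then have "(p \<odot> (q \<odot> p) - \<alpha> \<cdot> w) - \<alpha> \<cdot> (q \<odot> p) - (\<mu> * (1 - \<alpha>)) \<cdot> p
      = (\<beta> * (\<beta> - \<alpha>)) \<cdot> z - \<alpha> \<cdot> w"
    by (simp add: algebra_simps)
  then show ?thesis
    using p_pq p_in_W0 qp_in_W0
    by (metis span_diff span_scale)
qed

lemma x_mod_W0: "\<beta> \<cdot> x - w \<in> W0"
proof -
  have x: "x = q - \<mu> \<cdot> p - y - z"
    using q_eq by (simp add: algebra_simps)
  have "(\<beta> - \<alpha>) \<cdot> (\<beta> \<cdot> x - w) = ((\<beta> - \<alpha>) * \<beta>) \<cdot> (q - \<mu> \<cdot> p)
      - \<beta> \<cdot> ((\<beta> - \<alpha>) \<cdot> y + w) - ((\<beta> * (\<beta> - \<alpha>)) \<cdot> z - \<alpha> \<cdot> w)"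
    unfolding x by (simp add: algebra_simps)
  also have "\<dots> \<in> W0"
    using y_mod_W0 z_mod_W0 p_in_W0 span_base[of q "{q, u, v}"] by (auto intro!: span_diff span_scale)
  finally have "(1 / (\<beta> - \<alpha>)) \<cdot> ((\<beta> - \<alpha>) \<cdot> (\<beta> \<cdot> x - w)) \<in> W0"
    by (rule span_scale)
  then show ?thesis
    using \<alpha>_n\<beta> by simp
qed

lemma W_scale_iff: "c \<noteq> 0 \<Longrightarrow> c \<cdot> e \<in> W \<longleftrightarrow> e \<in> W"
  by (metis span_scale scale_scale scale_one field_class.field_inverse)

lemma w_in_W: "w \<in> W"
  by (simp add: span_base)

lemma xyz_in_W: "x \<in> W" "y \<in> W" "z \<in> W"
proof -
  have "(\<beta> \<cdot> x - w) + w \<in> W"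
    using x_mod_W0 W0_subset w_in_W by (blast intro: span_add)
  then show "x \<in> W"
    using \<beta>_nz by (simp add: W_scale_iff)
  have "((\<beta> - \<alpha>) \<cdot> y + w) - w \<in> W"
    using y_mod_W0 W0_subset w_in_W by (blast intro: span_diff)
  then show "y \<in> W"
    using \<alpha>_n\<beta> by (simp add: W_scale_iff)
  have "((\<beta> * (\<beta> - \<alpha>)) \<cdot> z - \<alpha> \<cdot> w) + \<alpha> \<cdot> w \<in> W"
    using z_mod_W0 W0_subset w_in_W by (blast intro: span_add span_scale)
  then show "z \<in> W"
    using \<alpha>_n\<beta> \<beta>_nz by (simp add: W_scale_iff)
qed

lemma V_gens:
  "p \<in> span {p, x, y, z}" "x \<in> span {p, x, y, z}"
  "y \<in> span {p, x, y, z}" "z \<in> span {p, x, y, z}"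
  by (simp_all add: span_base)

lemma V_mul_p: "e \<in> span {p, x, y, z} \<Longrightarrow> p \<odot> e \<in> span {p, x, y, z}"
  by (induction rule: span_induct_alt)
    (auto simp: bilinear_simps pp px py pz V_gens span_zero intro!: span_add span_scale)

text \<open>One spanning set consists of eigenvectors of \<open>p\<close>, the other of eigenvectors
  of \<open>q\<close>. Their agreement makes \<open>W\<close> stable under multiplication by both
  axes.\<close>

lemma W_eq: "W = span {p, x, y, z}"
proof (rule subset_antisym)
  let ?V = "span {p, x, y, z}"
  have p: "p \<in> ?V"
    by (simp add: span_base)
  have q: "q \<in> ?V"
    by (subst q_eq) (simp add: span_add span_scale span_base)
  have "\<alpha> \<cdot> v = p \<odot> q - \<kappa> \<cdot> q"
    by (simp add: mul_comm[of p q] qp)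
  then have "(1 / \<alpha>) \<cdot> (\<alpha> \<cdot> v) \<in> ?V"
    using q V_mul_p by (auto intro: span_scale span_diff)
  then have v: "v \<in> ?V"
    using \<alpha>_nz by simp
  have "u = p - \<kappa> \<cdot> q - v"
    using p_eq by (simp add: algebra_simps)
  then have u: "u \<in> ?V"
    using p q v by (metis span_diff span_scale)
  have "w = p \<odot> v - (1 / 2) \<cdot> v - (\<kappa> - \<kappa> * \<kappa>) \<cdot> q"
    by (simp add: pv)
  then have w: "w \<in> ?V"
    using V_mul_p q v by (metis span_diff span_scale)
  have "{q, u, v, w} \<subseteq> ?V"
    using q u v w by blast
  then show "W \<subseteq> ?V"
    by (rule span_minimal) (rule subspace_span)
  have "{p, x, y, z} \<subseteq> W"
    using xyz_in_W p_in_W0 W0_subset by blast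
  then show "?V \<subseteq> W"
    by (rule span_minimal) (rule subspace_span)
qed

lemma W_mul_p: "e \<in> W \<Longrightarrow> p \<odot> e \<in> W"
  using V_mul_p[of e] by (simp only: W_eq)

lemma W_mul_q: "e \<in> W \<Longrightarrow> q \<odot> e \<in> W"
  by (induction rule: span_induct_alt)
    (auto simp: bilinear_simps qq qu qv qw W_gens span_zero intro!: span_add span_scale)

text \<open>The sum of the two products is \<open>p \<odot> w\<close>, which lies in
  \<open>W\<close>. Multiplication by \<open>q\<close> kills \<open>u \<odot> w\<close> and scales
  \<open>v \<odot> w\<close> by \<alpha>, which separates them.\<close>

lemma uw_vw_in_W: "u \<odot> w \<in> W" "v \<odot> w \<in> W"
proof -
  have pw: "p \<odot> w = u \<odot> w + v \<odot> w"
    by (subst p_eq) (simp add: bilinear_simps qw)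
  have "p \<odot> w \<in> W"
    by (intro W_mul_p w_in_W)
  then have *: "u \<odot> w + v \<odot> w \<in> W"
    by (simp add: pw)
  have "q \<odot> (u \<odot> w + v \<odot> w) = \<alpha> \<cdot> (v \<odot> w)"
    using J_facts(2)[OF qu qw] J_facts(3)[OF qw qv] by (simp add: bilinear_simps mul_comm[of w v])
  then have "\<alpha> \<cdot> (v \<odot> w) \<in> W"
    using W_mul_q[OF *] by simp
  then show "v \<odot> w \<in> W"
    using \<alpha>_nz by (simp add: W_scale_iff)
  then show "u \<odot> w \<in> W"
    using * span_diff by fastforce
qed

lemma W_mul_W0: "a \<in> W0 \<Longrightarrow> e \<in> W \<Longrightarrow> a \<odot> e \<in> W"
proof (induction rule: span_induct_alt)
  case base
  show ?case by (simp add: span_zero)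
next
  case (step c a b)
  have "u \<odot> e \<in> W"
    using step.prems
  proof (induction rule: span_induct_alt)
    case (step c a' b')
    moreover have "u \<odot> a' \<in> W"
      using step(1) uw_vw_in_W qu
      by (auto simp: uu uv mul_comm[of u q] W_gens span_zero intro!: span_scale span_diff)
    ultimately show ?case
      by (simp add: bilinear_simps span_add span_scale)
  qed (simp add: span_zero)
  moreover have "v \<odot> e \<in> W"
    using step.prems
  proof (induction rule: span_induct_alt)
    case (step c a' b')
    moreover have "v \<odot> a' \<in> W"
      using step(1) uw_vw_in_W qv
      by (auto simp: vv uv mul_comm[of v q] mul_comm[of v u] W_gens intro!: span_scale span_add)
    ultimately show ?case
      by (simp add: bilinear_simps span_add span_scale)
  qed (simp add: span_zero)
  ultimately have "a \<odot> e \<in> W"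
    using step.hyps W_mul_q[OF step.prems] by auto
  then show ?case
    using step by (simp add: bilinear_simps span_add span_scale)
qed

text \<open>
  Modulo \<open>W\<close> both \<open>x \<odot> x\<close> and \<open>x \<odot> y\<close> are nonzero multiples of \<open>w \<odot> w\<close>, but they belong to
  different eigenspaces of \<open>p\<close>.
\<close>
lemma ww_in_W: "w \<odot> w \<in> W"
proof -
  define ex ey where "ex = \<beta> \<cdot> x - w" and "ey = (\<beta> - \<alpha>) \<cdot> y + w"
  have e: "ex \<in> W0" "ey \<in> W0"
    using x_mod_W0 y_mod_W0 by (simp_all add: ex_def ey_def)
  have "w \<odot> w = (\<beta> * \<beta>) \<cdot> (x \<odot> x) - (ex \<odot> (\<beta> \<cdot> x) + ex \<odot> w)"
    by (simp add: ex_def bilinear_simps mul_comm[of w x] scale_right_diff_distrib)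
  moreover have r1: "ex \<odot> (\<beta> \<cdot> x) + ex \<odot> w \<in> W"
    using e xyz_in_W w_in_W by (intro span_add W_mul_W0 span_scale) auto
  moreover have "p \<odot> (x \<odot> x) = 0"
    using M_facts(2)[OF px px] .
  ultimately have p_ww: "p \<odot> (w \<odot> w) \<in> W"
    using W_mul_p[OF r1] by (simp only: mul_diff_right mul_scale_right scale_zero_right diff_0 span_neg)
  have ww: "w \<odot> w = (- (\<beta> * (\<beta> - \<alpha>))) \<cdot> (x \<odot> y) + (ey \<odot> (\<beta> \<cdot> x) - ex \<odot> w)"
    by (simp add: ex_def ey_def bilinear_simps mul_comm[of w x] mul_comm[of y x] scale_right_diff_distrib
        scale_right_distrib algebra_simps)
  have r2: "ey \<odot> (\<beta> \<cdot> x) - ex \<odot> w \<in> W"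
    using e xyz_in_W w_in_W by (intro span_diff W_mul_W0 span_scale) auto
  have "p \<odot> (w \<odot> w) - p \<odot> (ey \<odot> (\<beta> \<cdot> x) - ex \<odot> w) = (- (\<alpha> * (\<beta> * (\<beta> - \<alpha>)))) \<cdot> (x \<odot> y)"
    unfolding ww mul_add_right using M_facts(3)[OF px py] by (simp add: bilinear_simps mult_ac)
  then have "(- (\<alpha> * (\<beta> * (\<beta> - \<alpha>)))) \<cdot> (x \<odot> y) \<in> W"
    using p_ww W_mul_p[OF r2] by (metis span_diff)
  then have "x \<odot> y \<in> W"
    using \<alpha>_nz \<beta>_nz \<alpha>_n\<beta> by (subst (asm) W_scale_iff) auto
  then show ?thesis
    unfolding ww using r2 by (intro span_add span_scale)
qed

text \<open>With \<open>w \<odot> w\<close> in \<open>W\<close>, all products of its spanning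
  vectors lie in \<open>W\<close>, so \<open>W\<close> is a subalgebra containing both
  generators.\<close>

lemma W_UNIV: "W = UNIV"
proof -
  have "a \<odot> e \<in> W" if "a \<in> W" "e \<in> W" for a e
    using that(1)
  proof (induction rule: span_induct_alt)
    case (step c a b)
    have "w \<odot> e \<in> W"
      using that(2)
    proof (induction rule: span_induct_alt)
      case (step c a' b')
      have "w \<odot> a' \<in> W"
        using step(1) uw_vw_in_W qw ww_in_W
        by (auto simp: mul_comm[of w q] mul_comm[of w u] mul_comm[of w v] span_zero)
      then show ?case
        using step by (simp add: bilinear_simps span_add span_scale)
    qed (simp add: span_zero)
    moreover have "a \<odot> e \<in> W" if "a \<in> {q, u, v}"
      using span_base[OF that] \<open>e \<in> W\<close> by (rule W_mul_W0)
    ultimately have "a \<odot> e \<in> W"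
      using step(1) by auto
    then show ?case
      using step by (simp add: bilinear_simps span_add span_scale)
  qed (simp add: span_zero)
  then have "subalgebra W"
    by (simp add: subalgebra_def)
  moreover have "{p, q} \<subseteq> W"
    using p_in_W0 W0_subset by (auto simp: span_base)
  ultimately have "subalgebra hull {p, q} \<subseteq> W"
    by (rule hull_minimal[rotated])
  then show ?thesis
    using gen by (auto simp: generates_def)
qed

section \<open>Eigenspaces of both axes in the whole algebra\<close>

lemma span4: "e \<in> span {a, b, c, d} \<longleftrightarrow> (\<exists>k1 k2 k3 k4. e = k1 \<cdot> a + k2 \<cdot> b + k3 \<cdot> c + k4 \<cdot> d)"
  by (simp add: span_breakdown_eq diff_diff_eq)

lemma p_expansion: "\<exists>k1 k2 k3 k4. e = k1 \<cdot> p + k2 \<cdot> x + k3 \<cdot> y + k4 \<cdot> z"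
  using W_UNIV by (simp add: W_eq flip: span4)

lemma q_expansion: "\<exists>k1 k2 k3 k4. e = k1 \<cdot> q + k2 \<cdot> u + k3 \<cdot> v + k4 \<cdot> w"
  using W_UNIV by (simp flip: span4)

text \<open>Expand \<open>e\<close> in \<open>p, x, y, z\<close> and compare \<open>0\<close>-parts.
  With the next two lemmas, the eigenspaces of \<open>p\<close> are at most lines, so each fusion
  rule yields only a few scalars.\<close>

lemma zero_space_p: assumes "p \<odot> e = 0" shows "\<exists>k. e = k \<cdot> x"
proof -
  obtain k1 k2 k3 k4 where e: "e = k1 \<cdot> p + k2 \<cdot> x + k3 \<cdot> y + k4 \<cdot> z"
    using p_expansion by blast
  then have "k1 \<cdot> p + (k2 \<cdot> x - e) + k3 \<cdot> y + k4 \<cdot> z = 0"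
    by (simp add: algebra_simps)
  then have "k2 \<cdot> x - e = 0"
    using assms by (intro p_independent[THEN conjunct2, THEN conjunct1, of "k2 \<cdot> x - e" _ _ k1])
      (auto simp: bilinear_simps px py pz mult.commute)
  then show ?thesis by auto
qed

lemma \<alpha>_space_p: assumes "p \<odot> e = \<alpha> \<cdot> e" shows "\<exists>k. e = k \<cdot> y"
proof -
  obtain k1 k2 k3 k4 where e: "e = k1 \<cdot> p + k2 \<cdot> x + k3 \<cdot> y + k4 \<cdot> z"
    using p_expansion by blast
  then have "k1 \<cdot> p + k2 \<cdot> x + (k3 \<cdot> y - e) + k4 \<cdot> z = 0"
    by (simp add: algebra_simps)
  then have "k3 \<cdot> y - e = 0"
    using assms p_independent[of "k2 \<cdot> x" "k3 \<cdot> y - e" "k4 \<cdot> z" k1]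
    by (auto simp: bilinear_simps px py pz mult.commute scale_right_diff_distrib)
  then show ?thesis by auto
qed

lemma \<beta>_space_p: assumes "p \<odot> e = \<beta> \<cdot> e" shows "\<exists>k. e = k \<cdot> z"
proof -
  obtain k1 k2 k3 k4 where e: "e = k1 \<cdot> p + k2 \<cdot> x + k3 \<cdot> y + k4 \<cdot> z"
    using p_expansion by blast
  then have "k1 \<cdot> p + k2 \<cdot> x + k3 \<cdot> y + (k4 \<cdot> z - e) = 0"
    by (simp add: algebra_simps)
  then have "k4 \<cdot> z - e = 0"
    using assms p_independent[of "k2 \<cdot> x" "k3 \<cdot> y" "k4 \<cdot> z - e" k1]
    by (auto simp: bilinear_simps px py pz mult.commute scale_right_diff_distrib)
  then show ?thesis by auto
qed

text \<open>Since \<open>q\<close> kills \<open>u\<close> and \<open>w\<close>, its image is spanned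
  by \<open>q\<close> and \<open>v\<close>, hence by \<open>q\<close> and
  \<open>q \<odot> p\<close>. This is the bound on the rank.\<close>

lemma q_mul: "\<exists>a b. q \<odot> e = a \<cdot> q + b \<cdot> (q \<odot> p)"
proof -
  obtain k1 k2 k3 k4 where e: "e = k1 \<cdot> q + k2 \<cdot> u + k3 \<cdot> v + k4 \<cdot> w"
    using q_expansion by blast
  have "q \<odot> e = (k1 - k3 * \<kappa>) \<cdot> q + k3 \<cdot> (q \<odot> p)"
    by (simp add: e bilinear_simps qq qu qv qw qp algebra_simps)
  then show ?thesis by blast
qed

text \<open>The fusion law puts \<open>e \<odot> v\<close> into the \<alpha>-eigenspace of
  \<open>q\<close>, which is spanned by \<open>v\<close> because \<open>u\<close> and
  \<open>w\<close> belong to the eigenvalue \<open>0\<close>.\<close>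

lemma zero_space_q_mul_v: assumes "q \<odot> e = 0" shows "\<exists>k. e \<odot> v = k \<cdot> v"
proof -
  obtain k1 k2 k3 k4 where e: "e \<odot> v = k1 \<cdot> q + k2 \<cdot> u + k3 \<cdot> v + k4 \<cdot> w"
    using q_expansion by blast
  then have "k1 \<cdot> q + (k2 \<cdot> u + k4 \<cdot> w) + (k3 \<cdot> v - e \<odot> v) = 0"
    by (simp add: algebra_simps)
  then have "k3 \<cdot> v - e \<odot> v = 0"
    using J_facts(3)[OF assms qv] q_independent[of "k2 \<cdot> u + k4 \<cdot> w" "k3 \<cdot> v - e \<odot> v" k1]
    by (auto simp: bilinear_simps qu qv qw mult.commute scale_right_diff_distrib)
  then show ?thesis by (metis right_minus_eq)
qed

end

section \<open>Structure constants\<close>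

context axis_pair
begin

text \<open>The \<beta>-eigenspace is spanned by \<open>z\<close>, and the two fusion laws agree on
  the eigenvalues 0, 1, \<alpha>.\<close>

lemma J_axis_if_no_\<beta>_part:
  assumes "z = 0"
  shows "primitive_axis (J_law \<alpha>) p"
proof -
  have "eigenspace p \<beta> = {0}"
    using \<beta>_space_p assms by (auto simp: eigenspace_def)
  then have "eigenspaces p {0, 1, \<alpha>, \<beta>} = eigenspaces p {0, 1, \<alpha>}"
    unfolding eigenspaces_def by (simp add: Un_insert_left insert_commute flip: Un_assoc)
  moreover have "law_star (J_law \<alpha>) l m = law_star (M_law \<alpha> \<beta>) l m"
    if "l \<in> {0, 1, \<alpha>}" "m \<in> {0, 1, \<alpha>}" for l m
    using that \<alpha>_nz \<alpha>_n1 \<beta>_nz \<beta>_n1 \<alpha>_n\<beta> by (auto simp: J_law_def M_law_def doubleton_eq_iff)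
  moreover have "law_carrier (J_law \<alpha>) = {0, 1, \<alpha>}" "law_carrier (M_law \<alpha> \<beta>) = {0, 1, \<alpha>, \<beta>}"
    by (simp_all add: J_law_def M_law_def)
  ultimately show ?thesis
    using axis_p by (auto simp: primitive_axis_def)
qed

end

text \<open>Three groups of constants: the products of \<open>x, y, z\<close> as the fusion law of
  \<open>p\<close> allows them, the images under \<open>q\<close> as the rank bound allows them, and
  the scalars \<open>h1, h2\<close> supplied by \<open>zero_space_q_mul_v\<close>. Since
  \<open>x\<close> or \<open>y\<close> may still be zero, some of these constants are not determined
  by the algebra.\<close>

locale axis_pair_table = axis_pair scale mul \<alpha> \<beta> p q \<mu> \<kappa> x y z u v
  for scale :: "'f::field \<Rightarrow> 'a::ab_group_add \<Rightarrow> 'a" (infixr "\<cdot>" 75)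
    and mul :: "'a \<Rightarrow> 'a \<Rightarrow> 'a" (infixl "\<odot>" 77)
    and \<alpha> \<beta> p q \<mu> \<kappa> x y z u v +
  fixes r s t1 t2 m n c1 c2 c3 a1 b1 a2 b2 a3 b3 h1 h2 :: 'f
  assumes z_nz: "z \<noteq> 0"
    and xx: "x \<odot> x = r \<cdot> x" and xy: "x \<odot> y = s \<cdot> y" and xz: "x \<odot> z = m \<cdot> z"
    and yy: "y \<odot> y = t1 \<cdot> p + t2 \<cdot> x" and yz: "y \<odot> z = n \<cdot> z"
    and zz: "z \<odot> z = c1 \<cdot> p + c2 \<cdot> x + c3 \<cdot> y"
    and qx: "q \<odot> x = a1 \<cdot> q + b1 \<cdot> (q \<odot> p)"
    and qy: "q \<odot> y = a2 \<cdot> q + b2 \<cdot> (q \<odot> p)"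
    and qz: "q \<odot> z = a3 \<cdot> q + b3 \<cdot> (q \<odot> p)"
    and k1_mul_v: "(x - a1 \<cdot> q - b1 \<cdot> p) \<odot> v = h1 \<cdot> v"
    and k2_mul_v: "(y - a2 \<cdot> q - b2 \<cdot> p) \<odot> v = h2 \<cdot> v"
begin

section \<open>Coordinates with respect to \<open>p, x, y, z\<close>\<close>

definition C :: "'f \<Rightarrow> 'f \<Rightarrow> 'f \<Rightarrow> 'f \<Rightarrow> 'a" where
  "C a b c d = a \<cdot> p + b \<cdot> x + c \<cdot> y + d \<cdot> z"

lemma C_add: "C a b c d + C a' b' c' d' = C (a + a') (b + b') (c + c') (d + d')"
  by (simp add: C_def algebra_simps)

lemma C_diff: "C a b c d - C a' b' c' d' = C (a - a') (b - b') (c - c') (d - d')"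
  by (simp add: C_def algebra_simps)

lemma C_scale: "e \<cdot> C a b c d = C (e * a) (e * b) (e * c) (e * d)"
  by (simp add: C_def algebra_simps)

lemma p_C: "p = C 1 0 0 0" and x_C: "x = C 0 1 0 0" and y_C: "y = C 0 0 1 0" and z_C: "z = C 0 0 0 1"
  and qp_C: "q \<odot> p = C \<mu> 0 \<alpha> \<beta>"
  by (simp_all add: C_def qp')

lemma q_C: "q = C \<mu> 1 1 1"
  by (simp add: C_def q_eq)

lemmas C_ops = C_add C_diff C_scale

lemma C_mul: "C a b c d \<odot> C a' b' c' d' =
  C (a * a' + c * c' * t1 + d * d' * c1) (b * b' * r + c * c' * t2 + d * d' * c2)
    ((a * c' + c * a') * \<alpha> + (b * c' + c * b') * s + d * d' * c3)
    ((a * d' + d * a') * \<beta> + (b * d' + d * b') * m + (c * d' + d * c') * n)"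
proof -
  have "C a b c d \<odot> C a' b' c' d' = a \<cdot> a' \<cdot> p + (a * c' + c * a') \<cdot> \<alpha> \<cdot> y + (a * d' + d * a') \<cdot> \<beta> \<cdot> z
    + (b * b') \<cdot> r \<cdot> x + (b * c' + c * b') \<cdot> s \<cdot> y + (b * d' + d * b') \<cdot> m \<cdot> z
    + (c * c') \<cdot> (t1 \<cdot> p + t2 \<cdot> x) + (c * d' + d * c') \<cdot> n \<cdot> z
    + (d * d') \<cdot> (c1 \<cdot> p + c2 \<cdot> x + c3 \<cdot> y)"
    unfolding C_def
    by (simp add: bilinear_simps pp px py pz xx xy xz yy yz zz mul_comm[of x p] mul_comm[of y p]
        mul_comm[of z p] mul_comm[of y x] mul_comm[of z x] mul_comm[of z y] algebra_simps)
  then show ?thesis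
    by (simp add: C_def algebra_simps)
qed

lemma p_nz: "p \<noteq> 0"
  using pz z_nz \<beta>_nz by auto

text \<open>A coordinate of \<open>x\<close> or \<open>y\<close> carries information only if that
  vector is nonzero, hence the disjunctions; \<open>p\<close> and \<open>z\<close> are
  nonzero.\<close>

lemma C_eq_0: "C a b c d = 0 \<longleftrightarrow> a = 0 \<and> (x = 0 \<or> b = 0) \<and> (y = 0 \<or> c = 0) \<and> d = 0"
proof
  assume "C a b c d = 0"
  then have "a \<cdot> p = 0 \<and> b \<cdot> x = 0 \<and> c \<cdot> y = 0 \<and> d \<cdot> z = 0"
    by (intro p_independent) (simp_all add: C_def mul_scale_right px py pz mult.commute)
  then show "a = 0 \<and> (x = 0 \<or> b = 0) \<and> (y = 0 \<or> c = 0) \<and> d = 0"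
    using p_nz z_nz by auto
qed (auto simp: C_def)

lemma C_eq_iff: "C a b c d = C a' b' c' d' \<longleftrightarrow>
    a = a' \<and> (x = 0 \<or> b = b') \<and> (y = 0 \<or> c = c') \<and> d = d'"
  using C_eq_0[of "a - a'" "b - b'" "c - c'" "d - d'"] by (simp flip: C_diff)

lemma q_nz: "q \<noteq> 0"
  unfolding q_C by (simp add: C_eq_0)

text \<open>Otherwise \<open>q \<odot> p = \<kappa> \<cdot> q\<close>. The
  \<open>z\<close>-coordinate gives \<open>\<kappa> = \<beta>\<close>, the others then leave
  \<open>q = z\<close>; but \<open>z \<odot> z\<close> has no \<open>z\<close>-part, so
  \<open>z\<close> is not idempotent.\<close>

lemma v_nz: "v \<noteq> 0"
proof
  assume "v = 0"
  then have "C \<mu> 0 \<alpha> \<beta> = \<kappa> \<cdot> C \<mu> 1 1 1"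
    using qp qp_C q_C by simp
  then have "x = 0" "y = 0" "\<mu> = 0"
    using \<beta>_nz \<beta>_n1 \<alpha>_n\<beta> by (auto simp: C_ops C_eq_iff)
  then have "z \<odot> z = z"
    using qq q_eq by simp
  then show False
    unfolding zz using C_eq_0[of c1 c2 c3 "-1"] by (simp add: C_def)
qed

lemma q_qp_independent:
  assumes "a \<cdot> q + b \<cdot> (q \<odot> p) = 0" shows "a = 0 \<and> b = 0"
proof -
  have "(a + b * \<kappa>) \<cdot> q + 0 + (b * \<alpha>) \<cdot> v = 0"
    using assms by (simp add: qp algebra_simps)
  then have "(a + b * \<kappa>) \<cdot> q = 0 \<and> (0::'a) = 0 \<and> (b * \<alpha>) \<cdot> v = 0"
    by (intro q_independent) (simp_all add: mul_scale_right qv mult.commute)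
  then show ?thesis
    using q_nz v_nz \<alpha>_nz by auto
qed

lemma q_qp_eq_iff: "a \<cdot> q + b \<cdot> (q \<odot> p) = a' \<cdot> q + b' \<cdot> (q \<odot> p) \<longleftrightarrow> a = a' \<and> b = b'"
  using q_qp_independent[of "a - a'" "b - b'"] by (auto simp: algebra_simps)

section \<open>Polynomial equations for the structure constants\<close>

lemma qq_q_coeff: "a1 + a2 + a3 = 1" and qq_qp_coeff: "\<mu> + b1 + b2 + b3 = 0"
proof -
  have "q \<odot> q = \<mu> \<cdot> (q \<odot> p) + q \<odot> x + q \<odot> y + q \<odot> z"
    by (subst (2) q_eq) (simp add: bilinear_simps)
  then have "(a1 + a2 + a3) \<cdot> q + (\<mu> + b1 + b2 + b3) \<cdot> (q \<odot> p) = 1 \<cdot> q + 0 \<cdot> (q \<odot> p)"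
    by (simp add: qq qx qy qz algebra_simps)
  then show "a1 + a2 + a3 = 1" "\<mu> + b1 + b2 + b3 = 0"
    by (simp_all only: q_qp_eq_iff)
qed

lemma q_qp_qp_coeff: "\<mu> + \<alpha> * b2 + \<beta> * b3 = \<alpha>" and q_qp_q_coeff: "\<alpha> * a2 + \<beta> * a3 = (1 - \<alpha>) * \<kappa>"
proof -
  have "q \<odot> (q \<odot> p) = \<mu> \<cdot> (q \<odot> p) + \<alpha> \<cdot> (q \<odot> y) + \<beta> \<cdot> (q \<odot> z)"
    using arg_cong[OF qp', of "mul q"] by (simp add: bilinear_simps)
  then have "(\<alpha> * a2 + \<beta> * a3) \<cdot> q + (\<mu> + \<alpha> * b2 + \<beta> * b3) \<cdot> (q \<odot> p)
      = ((1 - \<alpha>) * \<kappa>) \<cdot> q + \<alpha> \<cdot> (q \<odot> p)"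
    by (simp add: q_qp qy qz algebra_simps)
  then show "\<mu> + \<alpha> * b2 + \<beta> * b3 = \<alpha>" "\<alpha> * a2 + \<beta> * a3 = (1 - \<alpha>) * \<kappa>"
    by (simp_all only: q_qp_eq_iff)
qed

text \<open>The product \<open>q \<odot> x\<close> is computed from the multiplication table and
  from the rank bound. The next two lemmas do the same for \<open>y\<close> and
  \<open>z\<close>.\<close>

lemma qx_coords:
  "\<mu> * (a1 + b1) = 0" "x = 0 \<or> r = a1" "y = 0 \<or> s = a1 + b1 * \<alpha>" "m = a1 + b1 * \<beta>"
proof -
  have "C \<mu> 1 1 1 \<odot> C 0 1 0 0 = a1 \<cdot> C \<mu> 1 1 1 + b1 \<cdot> C \<mu> 0 \<alpha> \<beta>"
    using qx by (simp only: qp_C) (simp only: q_C flip: x_C)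
  then show "\<mu> * (a1 + b1) = 0" "x = 0 \<or> r = a1" "y = 0 \<or> s = a1 + b1 * \<alpha>" "m = a1 + b1 * \<beta>"
    unfolding C_mul C_ops C_eq_iff by (simp_all add: algebra_simps)
qed

lemma qy_coords:
  "t1 = \<mu> * (a2 + b2)" "x = 0 \<or> t2 = a2" "y = 0 \<or> \<mu> * \<alpha> + s = a2 + b2 * \<alpha>" "n = a2 + b2 * \<beta>"
proof -
  have "C \<mu> 1 1 1 \<odot> C 0 0 1 0 = a2 \<cdot> C \<mu> 1 1 1 + b2 \<cdot> C \<mu> 0 \<alpha> \<beta>"
    using qy by (simp only: qp_C) (simp only: q_C flip: y_C)
  then show "t1 = \<mu> * (a2 + b2)" "x = 0 \<or> t2 = a2" "y = 0 \<or> \<mu> * \<alpha> + s = a2 + b2 * \<alpha>" "n = a2 + b2 * \<beta>"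
    unfolding C_mul C_ops C_eq_iff by (simp_all add: algebra_simps)
qed

lemma qz_coords:
  "c1 = \<mu> * (a3 + b3)" "x = 0 \<or> c2 = a3" "y = 0 \<or> c3 = a3 + b3 * \<alpha>" "\<mu> * \<beta> + m + n = a3 + b3 * \<beta>"
proof -
  have "C \<mu> 1 1 1 \<odot> C 0 0 0 1 = a3 \<cdot> C \<mu> 1 1 1 + b3 \<cdot> C \<mu> 0 \<alpha> \<beta>"
    using qz by (simp only: qp_C) (simp only: q_C flip: z_C)
  then show "c1 = \<mu> * (a3 + b3)" "x = 0 \<or> c2 = a3" "y = 0 \<or> c3 = a3 + b3 * \<alpha>"
    "\<mu> * \<beta> + m + n = a3 + b3 * \<beta>"
    unfolding C_mul C_ops C_eq_iff by (simp_all add: algebra_simps)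
qed

text \<open>This is the \<open>z\<close>-coordinate of \<open>q \<odot> q = q\<close>, rewritten by
  \<open>qz_coords\<close>.\<close>

lemma qq_coord: "2 * (a3 + b3 * \<beta>) = 1"
proof -
  have "C \<mu> 1 1 1 \<odot> C \<mu> 1 1 1 = C \<mu> 1 1 1"
    using qq by (simp only: q_C)
  then have "2 * (\<mu> * \<beta> + m + n) = 1"
    unfolding C_mul C_ops C_eq_iff by (simp add: algebra_simps)
  then show ?thesis
    by (simp only: qz_coords(4))
qed

text \<open>By \<open>k1_mul_v\<close> and \<open>k2_mul_v\<close>, multiplication by these elements of the \<open>0\<close>-eigenspace of \<open>q\<close> scales \<open>v\<close>.
  They are chosen because \<open>\<alpha> \<cdot> u = \<beta> \<cdot> k1 + (\<beta> - \<alpha>) \<cdot> k2\<close>, which turns the known product \<open>u \<odot> v\<close> into an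
  equation for \<open>h1\<close> and \<open>h2\<close>.\<close>
definition k1 :: 'a where "k1 = x - a1 \<cdot> q - b1 \<cdot> p"
definition k2 :: 'a where "k2 = y - a2 \<cdot> q - b2 \<cdot> p"

lemma qk1: "q \<odot> k1 = 0" and qk2: "q \<odot> k2 = 0"
  by (simp_all add: k1_def k2_def bilinear_simps qq qx qy)

lemma k1v: "k1 \<odot> v = h1 \<cdot> v" and k2v: "k2 \<odot> v = h2 \<cdot> v"
  using k1_mul_v k2_mul_v by (simp_all add: k1_def k2_def)

lemma h1_h2_relation: "2 * \<beta> * h1 + 2 * (\<beta> - \<alpha>) * h2 = \<alpha> * (1 - 2 * \<kappa> * \<alpha>)"
proof -
  have "\<alpha> \<cdot> u = \<alpha> \<cdot> p - (\<alpha> * \<kappa>) \<cdot> q - \<alpha> \<cdot> v"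
    by (subst p_eq) (simp add: algebra_simps)
  also have "\<dots> = \<alpha> \<cdot> p + (\<kappa> * (1 - \<alpha>)) \<cdot> q - q \<odot> p"
    by (simp add: qp algebra_simps)
  \<comment> \<open>With \<open>k3 = z - a3 \<cdot> q - b3 \<cdot> p\<close> one has
    \<open>k1 + k2 + k3 = 0\<close>, and the left side is
    \<open>- \<alpha> \<cdot> k2 - \<beta> \<cdot> k3\<close>.\<close>
  also have "\<dots> = \<beta> \<cdot> k1 + (\<beta> - \<alpha>) \<cdot> k2"
  proof -
    have "\<alpha> \<cdot> C 1 0 0 0 + (\<alpha> * a2 + \<beta> * a3) \<cdot> C \<mu> 1 1 1 - C \<mu> 0 \<alpha> \<beta>
      = \<beta> \<cdot> (C 0 1 0 0 - a1 \<cdot> C \<mu> 1 1 1 - b1 \<cdot> C 1 0 0 0)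
        + (\<beta> - \<alpha>) \<cdot> (C 0 0 1 0 - a2 \<cdot> C \<mu> 1 1 1 - b2 \<cdot> C 1 0 0 0)"
      unfolding C_ops C_eq_iff
      by (intro conjI disjI2) (use qq_q_coeff qq_qp_coeff q_qp_qp_coeff in algebra)+
    then show ?thesis
      using q_qp_q_coeff unfolding k1_def k2_def qp_C by (simp add: mult.commute flip: p_C x_C y_C q_C)
  qed
  finally have "(\<alpha> \<cdot> u) \<odot> v = (\<beta> \<cdot> k1 + (\<beta> - \<alpha>) \<cdot> k2) \<odot> v"
    by simp
  then have "(\<alpha> * (1 / 2 - \<kappa> * \<alpha>)) \<cdot> v = (\<beta> * h1 + (\<beta> - \<alpha>) * h2) \<cdot> v"
    by (simp add: bilinear_simps uv k1v k2v scale_left_distrib)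
  then have "\<alpha> * (1 / 2 - \<kappa> * \<alpha>) = \<beta> * h1 + (\<beta> - \<alpha>) * h2"
    using v_nz by simp
  then show ?thesis
    using two_nz by (simp add: field_simps)
qed

text \<open>Compute \<open>k1 \<odot> (q \<odot> p)\<close> twice: from
  \<open>q \<odot> p = \<kappa> \<cdot> q + \<alpha> \<cdot> v\<close>, where \<open>k1\<close>
  kills \<open>q\<close> and scales \<open>v\<close>, and by expanding \<open>k1\<close>. The
  conclusions are the \<open>x\<close>- and \<open>z\<close>-coordinates; \<open>k2_coords\<close>
  is analogous.\<close>

lemma k1_coords:
  "x = 0 \<or> \<kappa> * (h1 - a1 * (1 - \<alpha>)) = 0" "(\<beta> - \<kappa>) * (h1 - a1 * (1 - \<alpha>)) = 0"
proof -
  have "k1 \<odot> (q \<odot> p) = h1 \<cdot> (q \<odot> p - \<kappa> \<cdot> q)"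
    by (simp add: qp bilinear_simps k1v mul_comm[of k1 q] qk1 mult.commute)
  moreover have "k1 \<odot> (q \<odot> p) = x \<odot> (q \<odot> p) - a1 \<cdot> (q \<odot> (q \<odot> p)) - b1 \<cdot> (p \<odot> (q \<odot> p))"
    by (simp add: k1_def bilinear_simps)
  ultimately have "C 0 1 0 0 \<odot> C \<mu> 0 \<alpha> \<beta> - a1 \<cdot> (\<alpha> \<cdot> C \<mu> 0 \<alpha> \<beta> + ((1 - \<alpha>) * \<kappa>) \<cdot> C \<mu> 1 1 1)
      - b1 \<cdot> (C 1 0 0 0 \<odot> C \<mu> 0 \<alpha> \<beta>) = h1 \<cdot> (C \<mu> 0 \<alpha> \<beta> - \<kappa> \<cdot> C \<mu> 1 1 1)"
    unfolding q_qp unfolding qp_C by (simp only: p_C[symmetric] x_C[symmetric] q_C[symmetric])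
  then show "x = 0 \<or> \<kappa> * (h1 - a1 * (1 - \<alpha>)) = 0" "(\<beta> - \<kappa>) * (h1 - a1 * (1 - \<alpha>)) = 0"
    unfolding C_mul C_ops C_eq_iff qx_coords(4) by (auto simp: algebra_simps)
qed

lemma k2_coords:
  "\<alpha> * t1 - b2 * \<mu> - a2 * \<alpha> * \<mu> - a2 * (1 - \<alpha>) * \<kappa> * \<mu> = h2 * \<mu> * (1 - \<kappa>)"
  "x = 0 \<or> \<alpha> * t2 - a2 * (1 - \<alpha>) * \<kappa> = - (h2 * \<kappa>)"
  "y = 0 \<or> \<mu> * \<alpha> - (a2 + b2) * \<alpha> * \<alpha> - a2 * (1 - \<alpha>) * \<kappa> = h2 * (\<alpha> - \<kappa>)"
  "(\<beta> - \<kappa>) * (h2 - a2 * (1 - \<alpha>)) = 0"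
proof -
  have "k2 \<odot> (q \<odot> p) = h2 \<cdot> (q \<odot> p - \<kappa> \<cdot> q)"
    by (simp add: qp bilinear_simps k2v mul_comm[of k2 q] qk2 mult.commute)
  moreover have "k2 \<odot> (q \<odot> p) = y \<odot> (q \<odot> p) - a2 \<cdot> (q \<odot> (q \<odot> p)) - b2 \<cdot> (p \<odot> (q \<odot> p))"
    by (simp add: k2_def bilinear_simps)
  ultimately have "C 0 0 1 0 \<odot> C \<mu> 0 \<alpha> \<beta> - a2 \<cdot> (\<alpha> \<cdot> C \<mu> 0 \<alpha> \<beta> + ((1 - \<alpha>) * \<kappa>) \<cdot> C \<mu> 1 1 1)
      - b2 \<cdot> (C 1 0 0 0 \<odot> C \<mu> 0 \<alpha> \<beta>) = h2 \<cdot> (C \<mu> 0 \<alpha> \<beta> - \<kappa> \<cdot> C \<mu> 1 1 1)"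
    unfolding q_qp unfolding qp_C by (simp only: p_C[symmetric] y_C[symmetric] q_C[symmetric])
  then show "\<alpha> * t1 - b2 * \<mu> - a2 * \<alpha> * \<mu> - a2 * (1 - \<alpha>) * \<kappa> * \<mu> = h2 * \<mu> * (1 - \<kappa>)"
    "x = 0 \<or> \<alpha> * t2 - a2 * (1 - \<alpha>) * \<kappa> = - (h2 * \<kappa>)"
    "y = 0 \<or> \<mu> * \<alpha> - (a2 + b2) * \<alpha> * \<alpha> - a2 * (1 - \<alpha>) * \<kappa> = h2 * (\<alpha> - \<kappa>)"
    "(\<beta> - \<kappa>) * (h2 - a2 * (1 - \<alpha>)) = 0"
    unfolding C_mul C_ops C_eq_iff qy_coords(4) by (auto simp: algebra_simps)
qed

text \<open>Products of \<open>0\<close>-eigenvectors of \<open>q\<close> are again killed by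
  \<open>q\<close>. The equation is the coefficient of \<open>q \<odot> p\<close> in
  \<open>q \<odot> (k1 \<odot> k1) = 0\<close>; the next two lemmas treat the products with
  \<open>k2\<close>.\<close>

lemma k1k1: "b1 * (r + b1) = 0"
proof -
  have "k1 \<odot> k1 = x \<odot> x - a1 \<cdot> (q \<odot> x) - a1 \<cdot> (q \<odot> k1) - b1 \<cdot> (p \<odot> x)
      - b1 \<cdot> (p \<odot> x - a1 \<cdot> (q \<odot> p) - b1 \<cdot> (p \<odot> p))"
    by (simp add: k1_def bilinear_simps mul_comm[of x q] mul_comm[of x p] mul_comm[of p q] algebra_simps)
  also have "\<dots> = r \<cdot> x - (a1 * a1) \<cdot> q + (b1 * b1) \<cdot> p"
    by (simp add: xx px qx qk1 pp algebra_simps)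
  finally have "q \<odot> (r \<cdot> x - (a1 * a1) \<cdot> q + (b1 * b1) \<cdot> p) = 0"
    using J_facts(2)[OF qk1 qk1] by simp
  then have "(r * a1 - a1 * a1) \<cdot> q + (r * b1 + b1 * b1) \<cdot> (q \<odot> p) = 0"
    by (simp add: bilinear_simps qx qq algebra_simps)
  then show ?thesis
    using q_qp_independent by (metis distrib_left mult.commute)
qed

lemma k1k2: "(s - b1 * \<alpha>) * b2 + b1 * b2 = 0"
proof -
  have "k1 \<odot> k2 = x \<odot> y - a1 \<cdot> (q \<odot> y) - a2 \<cdot> (q \<odot> k1) - b1 \<cdot> (p \<odot> y)
      - b2 \<cdot> (p \<odot> x - a1 \<cdot> (q \<odot> p) - b1 \<cdot> (p \<odot> p))"
    by (simp add: k1_def k2_def bilinear_simps mul_comm[of x q] mul_comm[of x p] mul_comm[of p q]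
        mul_comm[of y q] mul_comm[of y p] algebra_simps)
  also have "\<dots> = (s - b1 * \<alpha>) \<cdot> y - (a1 * a2) \<cdot> q + (b1 * b2) \<cdot> p"
    by (simp add: xy px py qy qk1 pp algebra_simps)
  finally have "q \<odot> ((s - b1 * \<alpha>) \<cdot> y - (a1 * a2) \<cdot> q + (b1 * b2) \<cdot> p) = 0"
    using J_facts(2)[OF qk1 qk2] by simp
  then have "((s - b1 * \<alpha>) * a2 - a1 * a2) \<cdot> q + ((s - b1 * \<alpha>) * b2 + b1 * b2) \<cdot> (q \<odot> p) = 0"
    by (simp add: bilinear_simps qy qq algebra_simps)
  then show ?thesis
    using q_qp_independent by blast
qed

lemma k2k2: "t2 * a1 - a2 * a2 - 2 * b2 * \<alpha> * a2 = 0" "t1 + b2 * b2 + t2 * b1 - 2 * b2 * \<alpha> * b2 = 0"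
proof -
  have "k2 \<odot> k2 = y \<odot> y - a2 \<cdot> (q \<odot> y) - a2 \<cdot> (q \<odot> k2) - b2 \<cdot> (p \<odot> y)
      - b2 \<cdot> (p \<odot> y - a2 \<cdot> (q \<odot> p) - b2 \<cdot> (p \<odot> p))"
    by (simp add: k2_def bilinear_simps mul_comm[of p q]
        mul_comm[of y q] mul_comm[of y p] algebra_simps)
  also have "\<dots> = (t1 + b2 * b2) \<cdot> p + t2 \<cdot> x - (a2 * a2) \<cdot> q - (2 * (b2 * \<alpha>)) \<cdot> y"
    unfolding mult_2 scale_left_distrib by (simp add: yy py qy qk2 pp algebra_simps)
  finally have "q \<odot> ((t1 + b2 * b2) \<cdot> p + t2 \<cdot> x - (a2 * a2) \<cdot> q - (2 * (b2 * \<alpha>)) \<cdot> y) = 0"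
    using J_facts(2)[OF qk2 qk2] by simp
  then have "(t2 * a1 - a2 * a2 - 2 * b2 * \<alpha> * a2) \<cdot> q
      + (t1 + b2 * b2 + t2 * b1 - 2 * b2 * \<alpha> * b2) \<cdot> (q \<odot> p) = 0"
    by (simp add: bilinear_simps qx qy qq algebra_simps)
  from q_qp_independent[OF this]
  show "t2 * a1 - a2 * a2 - 2 * b2 * \<alpha> * a2 = 0" "t1 + b2 * b2 + t2 * b1 - 2 * b2 * \<alpha> * b2 = 0"
    by (simp_all add: algebra_simps)
qed

lemma x_0: assumes "x = 0" shows "a1 = 0" "b1 = 0" "h1 = 0"
proof -
  have "a1 = 0 \<and> b1 = 0"
    using qx assms by (intro q_qp_independent) simp
  then show "a1 = 0" "b1 = 0" "h1 = 0"
    using k1_mul_v assms v_nz by auto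
qed

lemma y_0: assumes "y = 0" shows "a2 = 0" "b2 = 0" "h2 = 0"
proof -
  have "a2 = 0 \<and> b2 = 0"
    using qy assms by (intro q_qp_independent) simp
  then show "a2 = 0" "b2 = 0" "h2 = 0"
    using k2_mul_v assms v_nz by auto
qed

end

section \<open>Solving for the structure constants\<close>

context axis_pair_table
begin

lemma two_cancel: "2 * a = 0 \<Longrightarrow> a = 0" for a :: 'f
  using two_nz by simp

text \<open>If only \<open>p\<close> and \<open>z\<close> remained, the equations left over would
  force \<open>\<alpha> = \<beta>\<close>.\<close>

lemma x_or_y_nz: "x \<noteq> 0 \<or> y \<noteq> 0"
proof (rule ccontr)
  assume "\<not> (x \<noteq> 0 \<or> y \<noteq> 0)"
  then have xy: "a1 = 0" "b1 = 0" "h1 = 0" "a2 = 0" "b2 = 0" "h2 = 0"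
    using x_0 y_0 by auto
  have "2 * \<kappa> * \<alpha> = 1"
    using h1_h2_relation xy \<alpha>_nz by simp
  moreover have "b3 = - \<mu>" "a3 = 1" "\<mu> + \<beta> * b3 = \<alpha>" "\<beta> * a3 = (1 - \<alpha>) * \<kappa>"
    using qq_q_coeff qq_qp_coeff q_qp_qp_coeff q_qp_q_coeff xy by (simp_all add: eq_neg_iff_add_eq_0 add.commute)
  ultimately have "\<alpha> = \<beta>"
    using qq_coord by algebra
  then show False
    using \<alpha>_n\<beta> by blast
qed

text \<open>The factors \<kappa> and \<open>\<beta> - \<kappa>\<close> in \<open>k1_coords\<close>
  add up to \<beta>, which is nonzero.\<close>

lemma h1_eq: "h1 = a1 * (1 - \<alpha>)"
proof (cases "x = 0")
  case True
  then show ?thesis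
    using x_0 by simp
next
  case False
  then show ?thesis
    using k1_coords \<beta>_nz by auto
qed

text \<open>If \<open>a1 + b1\<close> were nonzero, then \<mu>, \<open>b1\<close>, \<open>b2\<close>
  and hence \<open>b3\<close> would vanish, and \<open>q_qp_qp_coeff\<close> would give
  \<open>\<alpha> = 0\<close>.\<close>

lemma b1_eq: "b1 = - a1"
proof (cases "x = 0")
  case True
  then show ?thesis
    using x_0 by simp
next
  case False
  then have r: "r = a1"
    using qx_coords(2) by blast
  show ?thesis
  proof (rule ccontr)
    assume "b1 \<noteq> - a1"
    then have nz: "a1 + b1 \<noteq> 0"
      by (simp add: eq_neg_iff_add_eq_0 add.commute)
    then have 0: "\<mu> = 0" "b1 = 0"
      using qx_coords(1) k1k1 r by auto
    have "b2 = 0"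
    proof (cases "y = 0")
      case True
      then show ?thesis
        by (rule y_0)
    next
      case False
      then have "(a1 + b1) * b2 = 0"
        using k1k2 qx_coords(3) by (simp add: algebra_simps)
      then show ?thesis
        using nz by simp
    qed
    then show False
      using qq_qp_coeff q_qp_qp_coeff 0 \<alpha>_nz by simp
  qed
qed

text \<open>By \<open>k2_coords(4)\<close>, either \<open>\<kappa> = \<beta>\<close> or
  \<open>h2 = a2 * (1 - \<alpha>)\<close>. The latter forces \<open>b2 = 0\<close> and then
  \<open>\<alpha> = 0\<close>. The former gives \<open>\<beta> * \<alpha> = 0\<close>, or makes
  \<alpha> a root of two quadratics whose difference is
  \<open>2 * \<alpha> * \<alpha>\<close>.\<close>

lemma x_nz: "x \<noteq> 0"
proof
  assume x: "x = 0"
  then have y: "y \<noteq> 0"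
    using x_or_y_nz by blast
  note x0 = x_0[OF x]
  have e: "\<mu> * \<alpha> = a2 + b2 * \<alpha>" "\<mu> * \<alpha> - (a2 + b2) * \<alpha> * \<alpha> - a2 * (1 - \<alpha>) * \<kappa> = h2 * (\<alpha> - \<kappa>)"
    using y x0 qx_coords(3) qy_coords(3) k2_coords(3) by auto
  have C2: "t1 + b2 * b2 - 2 * b2 * \<alpha> * b2 = 0" and C3: "a2 * (a2 + 2 * b2 * \<alpha>) = 0"
    using k2k2 x0 by (simp, algebra)
  have a3: "a3 = 1 - a2" and b3: "b3 = - \<mu> - b2"
    using qq_q_coeff qq_qp_coeff x0 by algebra+
  show False
  proof (cases "\<kappa> = \<beta>")
    case False
    then have "h2 = a2 * (1 - \<alpha>)"
      using k2_coords(4) by auto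
    then have "\<alpha> * (\<mu> - b2 * \<alpha> - a2) = 0"
      using e by algebra
    then have "\<mu> - b2 * \<alpha> - a2 = 0"
      using \<alpha>_nz by simp
    then have "\<mu> = b2 * \<alpha> + a2"
      by algebra
    moreover from this have "\<mu> * (1 - \<alpha>) = 0"
      using e(1) by algebra
    ultimately have 0: "\<mu> = 0" "a2 = - b2 * \<alpha>"
      using \<alpha>_n1 by (auto simp: eq_neg_iff_add_eq_0 add.commute)
    then have "b2 * b2 * (1 - 2 * \<alpha>) = 0"
      using C2 qy_coords(1) by algebra
    moreover have "2 * \<alpha> = - 1"
      using 0 q_qp_qp_coeff qq_coord a3 b3 by algebra
    ultimately have "b2 = 0"
      using two_nz by simp
    then show False
      using q_qp_qp_coeff b3 0 \<alpha>_nz by simp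
  next
    case True
    consider "a2 = 0" | "a2 = - 2 * b2 * \<alpha>"
      using C3 by (metis add_eq_0_iff2 mult_eq_0_iff mult_minus_left)
    then show False
    proof cases
      case 1
      then have "\<beta> * \<alpha> = 0"
        using q_qp_q_coeff a3 True by algebra
      then show False
        using \<alpha>_nz \<beta>_nz by simp
    next
      case 2
      then have "\<alpha> * (\<mu> + b2) = 0"
        using e(1) by algebra
      then have b2: "b2 = - \<mu>"
        using \<alpha>_nz by (simp add: eq_neg_iff_add_eq_0 add.commute)
      have f: "4 * \<mu> * \<alpha> = 1" "\<mu> * (1 - \<alpha>) = \<alpha>" "\<alpha> + \<beta> = 2 * (1 - \<alpha>) * \<beta>"
        using 2 b2 a3 b3 q_qp_qp_coeff q_qp_q_coeff qq_coord True by algebra+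
      have g: "2 * \<beta> = 1 + 3 * \<alpha>"
      proof -
        have a2: "2 * a2 = 1"
          using 2 b2 f(1) by algebra
        have "h2 * (\<alpha> - \<beta>) * 2 = \<alpha> * (2 * \<alpha> * \<beta> - 1)"
          using h1_h2_relation x0 True by algebra
        moreover have "h2 * (\<alpha> - \<beta>) * 4 = 1 - 2 * \<alpha> * \<alpha> + \<alpha> - 2 * (1 - \<alpha>) * \<beta>"
          using e(2) a2 b2 f(1) True by algebra
        ultimately have "2 * (2 * \<beta> - (1 + 3 * \<alpha>)) = 0"
          using f(3) by algebra
        then have "2 * \<beta> - (1 + 3 * \<alpha>) = 0"
          by (rule two_cancel)
        then show ?thesis
          by algebra
      qed
      have 4: "4 * \<alpha> * \<alpha> + \<alpha> - 1 = 0"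
        using f(1,2) by algebra
      have 6: "6 * \<alpha> * \<alpha> + \<alpha> - 1 = 0"
        using f(3) g by algebra
      have "2 * (\<alpha> * \<alpha>) = (6 * \<alpha> * \<alpha> + \<alpha> - 1) - (4 * \<alpha> * \<alpha> + \<alpha> - 1)"
        by (simp add: algebra_simps)
      then have "2 * (\<alpha> * \<alpha>) = 0"
        by (simp only: 4 6 diff_self)
      then show False
        using two_nz \<alpha>_nz by simp
    qed
  qed
qed

lemma y_zero_case:
  assumes "y = 0"
  shows "\<alpha> + \<beta> = 1" "2 * \<mu> = 1 + \<alpha>" "2 * r = \<alpha>" "2 * m = \<alpha> * \<alpha>"
    "4 * c1 = 1 - \<alpha> * \<alpha>" "2 * c2 = 2 - \<alpha>"
proof -
  note y0 = y_0[OF assms]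
  have r: "a1 = r" "b1 = - r" "h1 = r * (1 - \<alpha>)" "c2 = a3"
    using x_nz qx_coords(2) qz_coords(2) b1_eq h1_eq by auto
  have ab3: "a3 = 1 - r" "b3 = r - \<mu>"
    using qq_q_coeff qq_qp_coeff y0 r by algebra+
  have e: "2 * (r * (1 - \<beta>) + \<mu> * \<beta>) = 1" "\<mu> * (1 - \<beta>) + r * \<beta> = \<alpha>"
    "\<beta> * (1 - r) = (1 - \<alpha>) * \<kappa>" "2 * \<beta> * r * (1 - \<alpha>) = \<alpha> * (1 - 2 * \<kappa> * \<alpha>)"
    using qq_coord q_qp_qp_coeff q_qp_q_coeff h1_h2_relation r ab3 y0 by algebra+
  \<comment> \<open>Eliminating \<mu>, and below \<kappa>, leaves two linear equations in
    \<open>r\<close>; their compatibility is the condition on \<alpha> and \<beta>.\<close>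
  have "2 * r * (1 - 2 * \<beta>) = 1 - \<beta> - 2 * \<alpha> * \<beta>"
    using e by algebra
  moreover have "2 * \<beta> * r * (1 - 2 * \<alpha>) = \<alpha> * (1 - \<alpha> - 2 * \<alpha> * \<beta>)"
    using e by algebra
  ultimately have "(\<alpha> - \<beta>) * (\<alpha> + \<beta> - 1) = 0"
    by algebra
  then show ab: "\<alpha> + \<beta> = 1"
    using \<alpha>_n\<beta> by simp
  have "(\<alpha> - \<beta>) * (2 * r - \<alpha>) = 0"
    using e ab by algebra
  then show r2: "2 * r = \<alpha>"
    using \<alpha>_n\<beta> by simp
  have "\<beta> * (2 * \<mu> - 1 - \<alpha>) = 0"
    using e ab r2 by algebra
  then have "2 * \<mu> - 1 - \<alpha> = 0"
    using \<beta>_nz by simp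
  then show mu: "2 * \<mu> = 1 + \<alpha>"
    by algebra
  show "2 * m = \<alpha> * \<alpha>"
    using qx_coords(4) r ab r2 by algebra
  show "4 * c1 = 1 - \<alpha> * \<alpha>"
    using qz_coords(1) ab3 r2 mu by algebra
  show "2 * c2 = 2 - \<alpha>"
    using r2 by (simp add: r ab3 algebra_simps)
qed

text \<open>The values are stated with denominators cleared, which serves both characteristic 5,
  where residues are inserted, and the other characteristics.\<close>

lemma y_nz_case:
  assumes y: "y \<noteq> 0"
  shows "3 * \<alpha> = 1" "3 * \<beta> = 2" "12 * \<mu> = 5" "6 * r = 1" "9 * s = 1" "18 * m = 1"
    "144 * t1 = 5" "3 * t2 = 1" "6 * n = 1" "24 * c1 = 5" "2 * c2 = 1" "2 * c3 = 1"
proof -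
  have r: "a1 = r" "b1 = - r" "h1 = r * (1 - \<alpha>)" "c2 = a3" "t2 = a2"
    using x_nz qx_coords(2) qy_coords(2) qz_coords(2) b1_eq h1_eq by auto
  have s: "s = r - r * \<alpha>" "\<mu> * \<alpha> + s = a2 + b2 * \<alpha>" "c3 = a3 + b3 * \<alpha>"
    using y qx_coords(3) qy_coords(3) qz_coords(3) r by auto
  have k2y: "\<mu> * \<alpha> - (a2 + b2) * \<alpha> * \<alpha> - a2 * (1 - \<alpha>) * \<kappa> = h2 * (\<alpha> - \<kappa>)"
    and k2x: "\<alpha> * a2 - a2 * (1 - \<alpha>) * \<kappa> = - (h2 * \<kappa>)"
    using y x_nz k2_coords r by auto
  have ab3: "a3 = 1 - r - a2" "b3 = r - \<mu> - b2"
    using qq_q_coeff qq_qp_coeff r by algebra+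
  \<comment> \<open>Otherwise \<open>h2 = a2 * (1 - \<alpha>)\<close>, which makes
    \<open>a2\<close>, \<mu>, \<open>b2\<close> and \<open>r\<close> vanish one after another,
    against \<open>q_qp_qp_coeff\<close>.\<close>
  have \<kappa>: "\<kappa> = \<beta>"
  proof (rule ccontr)
    assume "\<kappa> \<noteq> \<beta>"
    then have h2: "h2 = a2 * (1 - \<alpha>)"
      using k2_coords(4) by auto
    then have "\<alpha> * a2 = 0"
      using k2x by algebra
    then have a2: "a2 = 0"
      using \<alpha>_nz by simp
    then have "\<alpha> * (\<mu> - b2 * \<alpha>) = 0"
      using k2y h2 by algebra
    then have \<mu>: "\<mu> = b2 * \<alpha>"
      using \<alpha>_nz by simp
    have "(1 - \<alpha>) * (b2 * \<mu>) = 0"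
      using k2_coords(1) qy_coords(1) a2 h2 by algebra
    then have 0: "\<mu> = 0" "b2 = 0"
      using \<mu> \<alpha>_n1 \<alpha>_nz by auto
    then have "r * (1 - \<alpha>) = 0"
      using s a2 by algebra
    then have "r = 0"
      using \<alpha>_n1 by simp
    then show False
      using q_qp_qp_coeff ab3 0 \<alpha>_nz by simp
  qed
  \<comment> \<open>With \<open>\<kappa> = \<beta>\<close>, the equations \<open>L1\<close> to
    \<open>L5\<close> are linear in \<open>r, a2, b2, \<mu>\<close>. Eliminating these leaves
    \<open>E1\<close> and \<open>E2\<close> in \<alpha> and \<beta> alone.\<close>
  have L1: "\<beta> * r = (\<alpha> - \<beta>) * a2 + \<alpha> * \<beta>"
    using q_qp_q_coeff ab3 \<kappa> by algebra
  have L2: "2 * (1 - r - a2 + (r - \<mu> - b2) * \<beta>) = 1"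
    using qq_coord ab3 by algebra
  have L3: "\<mu> + \<alpha> * b2 + \<beta> * (r - \<mu> - b2) = \<alpha>"
    using q_qp_qp_coeff ab3 by simp
  have L4: "\<mu> * \<alpha> + r * (1 - \<alpha>) = a2 + b2 * \<alpha>"
    using s by algebra
  have "\<alpha> * (\<beta> * (\<mu> - b2 * \<alpha>) - a2 * (2 * \<beta> - \<alpha>)) = 0"
    using k2y k2x \<kappa> by algebra
  then have L5: "\<beta> * (\<mu> - b2 * \<alpha>) = a2 * (2 * \<beta> - \<alpha>)"
    using \<alpha>_nz by simp
  have "\<alpha> * (2 * (\<alpha> - \<beta>) * a2 - \<beta> * (1 - 2 * \<beta>)) = 0"
    using h1_h2_relation L1 k2x r \<kappa> by algebra
  then have a2: "2 * (\<alpha> - \<beta>) * a2 = \<beta> * (1 - 2 * \<beta>)"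
    using \<alpha>_nz by simp
  have "\<beta> * (2 * r - 1 + 2 * \<beta> - 2 * \<alpha>) = 0"
    using L1 a2 by algebra
  then have "2 * r - 1 + 2 * \<beta> - 2 * \<alpha> = 0"
    using \<beta>_nz by simp
  then have r': "2 * r = 1 - 2 * \<beta> + 2 * \<alpha>"
    by algebra
  have M1: "\<mu> + \<alpha> * b2 = \<beta> - a2"
  proof -
    have "2 * (\<mu> + \<alpha> * b2 - (\<beta> - a2)) = 0"
      using L2 L3 r' by algebra
    then have "\<mu> + \<alpha> * b2 - (\<beta> - a2) = 0"
      by (rule two_cancel)
    then show ?thesis
      by algebra
  qed
  have "\<beta> * (4 * \<mu> - 4 * \<beta> + 1) = 0"
    using M1 L5 a2 by algebra
  then have "4 * \<mu> - 4 * \<beta> + 1 = 0"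
    using \<beta>_nz by simp
  then have \<mu>: "4 * \<mu> = 4 * \<beta> - 1"
    by algebra
  have M2: "2 * \<alpha> * b2 * \<beta> = \<beta> * \<beta> + a2 * (\<alpha> - 3 * \<beta>)"
    using M1 L5 a2 by algebra
  have "\<beta> * (8 * \<alpha> * \<beta> - 4 * \<beta> + 1 + \<alpha> - 4 * \<alpha> * \<alpha>) = 0"
    using M2 L4 \<mu> r' a2 by algebra
  then have E1: "8 * \<alpha> * \<beta> - 4 * \<beta> + 1 + \<alpha> - 4 * \<alpha> * \<alpha> = 0"
    using \<beta>_nz by simp
  \<comment> \<open>This is \<open>L2\<close> times \<open>2 * \<alpha>\<close> with
    \<open>b2\<close> removed by \<open>M2\<close>; the remaining \<open>a2\<close> terms combine to
    \<open>- 6 * (\<alpha> - \<beta>) * a2\<close>, which the equation \<open>a2\<close>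
    evaluates.\<close>
  have "2 * \<alpha> - 4 * \<alpha> * r + 4 * \<alpha> * \<beta> * r - 4 * \<alpha> * \<beta> * \<mu> - 2 * \<beta> * \<beta>
      - 3 * (\<beta> * (1 - 2 * \<beta>)) = 0"
    using M2 L2 a2 by algebra
  then have "7 * \<alpha> * \<beta> - 4 * \<alpha> * \<alpha> + 4 * \<alpha> * \<alpha> * \<beta> - 8 * \<alpha> * \<beta> * \<beta> + 4 * \<beta> * \<beta> - 3 * \<beta> = 0"
    using \<mu> r' by algebra
  then have E2: "8 * \<alpha> * \<beta> - 4 * \<alpha> * \<alpha> - 2 * \<beta> = 0"
    using E1 by algebra
  have "2 * \<beta> = \<alpha> + 1"
    using E1 E2 by algebra
  moreover from this show \<alpha>: "3 * \<alpha> = 1"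
    using E2 by algebra
  ultimately have "2 * (3 * \<beta> - 2) = 0"
    by algebra
  from two_cancel[OF this] show \<beta>: "3 * \<beta> = 2"
    by simp
  have three_nz: "(3::'f) \<noteq> 0"
    using \<alpha> by auto
  show \<mu>': "12 * \<mu> = 5" and r6: "6 * r = 1"
    using \<mu> r' \<alpha> \<beta> by algebra+
  have "2 * (3 * a2 - 1) = 0"
    using a2 \<alpha> \<beta> by algebra
  from two_cancel[OF this] have a2': "3 * a2 = 1"
    by simp
  have b2: "4 * b2 = - 1"
    using M1 \<mu>' a2' \<alpha> \<beta> by algebra
  have "3 * (2 * a3 - 1) = 0"
    using ab3 r6 a2' by algebra
  then have "2 * a3 - 1 = 0"
    using three_nz by (metis mult_eq_0_iff)
  then have a3: "2 * a3 = 1"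
    by simp
  have "2 * (2 * (3 * b3)) = 0"
    using ab3(2) \<mu>' b2 r6 by algebra
  from two_cancel[OF two_cancel[OF this]] have b3: "b3 = 0"
    using three_nz by simp
  show "18 * m = 1"
    using qx_coords(4) r r6 \<beta> by algebra
  have "2 * (9 * s - 1) = 0" "2 * (6 * n - 1) = 0"
    using s(1) qy_coords(4) r6 a2' b2 \<alpha> \<beta> by algebra+
  from this[THEN two_cancel] show "9 * s = 1" "6 * n = 1"
    by simp_all
  show "144 * t1 = 5"
    using qy_coords(1) \<mu>' a2' b2 by algebra
  show "24 * c1 = 5"
    using qz_coords(1) \<mu>' a3 b3 by algebra
  show "3 * t2 = 1" "2 * c2 = 1" "2 * c3 = 1"
    using r s(3) a2' a3 b3 by simp_all
qed

end

section \<open>Identification of the algebras\<close>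

context comm_algebra
begin

section \<open>Isomorphisms given by a basis\<close>

lemma mul_sum_left: "mul (sum f A) y = (\<Sum>i\<in>A. mul (f i) y)"
  by (induction A rule: infinite_finite_induct) (simp_all add: mul_add_left)

definition lin_comb :: "('n::finite \<Rightarrow> 'a) \<Rightarrow> 'f ^ 'n \<Rightarrow> 'a" where
  "lin_comb e c = (\<Sum>i\<in>UNIV. scale (c $ i) (e i))"

lemma lin_comb_add: "lin_comb e (c + d) = lin_comb e c + lin_comb e d"
  by (simp add: lin_comb_def scale_left_distrib sum.distrib)

lemma lin_comb_scale: "lin_comb e (k *s c) = scale k (lin_comb e c)"
  by (simp add: lin_comb_def scale_sum_right)

lemma lin_comb_0: "lin_comb e 0 = 0"
  by (simp add: lin_comb_def)

lemma lin_comb_minus: "lin_comb e (- c) = - lin_comb e c"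
  by (simp add: lin_comb_def sum_negf)

lemma lin_comb_diff: "lin_comb e (c - d) = lin_comb e c - lin_comb e d"
  by (simp add: lin_comb_def scale_left_diff_distrib sum_subtractf)

lemma lin_comb_bvec: "lin_comb e (bvec i) = e i"
proof -
  have "lin_comb e (bvec i) = (\<Sum>j\<in>UNIV. if j = i then e j else 0)"
    unfolding lin_comb_def by (intro sum.cong) (auto simp: bvec_nth)
  then show ?thesis
    by simp
qed

lemmas lin_comb_simps =
  lin_comb_add lin_comb_scale lin_comb_0 lin_comb_minus lin_comb_diff lin_comb_bvec

lemma lin_comb_sum: "lin_comb e (sum f A) = (\<Sum>i\<in>A. lin_comb e (f i))"
  by (induction A rule: infinite_finite_induct) (simp_all add: lin_comb_0 lin_comb_add)

text \<open>The isomorphism is the inverse of \<open>lin_comb e\<close>. Commutativity lets each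
  basis product be checked in one order; general products follow by expanding one factor at a
  time.\<close>

lemma algebra_isomorphic_if_basis:
  fixes e :: "'n::finite \<Rightarrow> 'a" and mul' :: "'f ^ 'n \<Rightarrow> 'f ^ 'n \<Rightarrow> 'f ^ 'n"
  assumes "comm_algebra (*s) mul'"
    and products: "\<And>i j. lin_comb e (mul' (bvec i) (bvec j)) = mul (e i) (e j) \<or>
                       lin_comb e (mul' (bvec j) (bvec i)) = mul (e j) (e i)"
    and indep: "\<And>c i. lin_comb e c = 0 \<Longrightarrow> c $ i = 0"
    and spanning: "\<And>a. a \<in> span (range e)"
  shows "algebra_isomorphic scale mul (*s) mul'"
proof -
  interpret V: comm_algebra "(*s)" mul'
    by fact
  have expand: "c = (\<Sum>i\<in>UNIV. c $ i *s bvec i)" for c :: "'f ^ 'n"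
    by (simp add: basis_expansion)
  have prod_basis: "lin_comb e (mul' (bvec i) (bvec j)) = mul (e i) (e j)" for i j
    using products[of i j] by (metis V.mul_comm mul_comm)
  have prod_right: "lin_comb e (mul' (bvec i) d) = mul (e i) (lin_comb e d)" for i d
  proof -
    have "mul' d (bvec i) = (\<Sum>j\<in>UNIV. d $ j *s mul' (bvec j) (bvec i))"
      by (subst expand[of d]) (simp add: V.mul_sum_left V.mul_scale_left)
    then have "lin_comb e (mul' d (bvec i)) = (\<Sum>j\<in>UNIV. scale (d $ j) (mul (e j) (e i)))"
      by (simp add: lin_comb_sum lin_comb_scale prod_basis)
    then show ?thesis
      by (simp add: lin_comb_def mul_sum_left mul_scale_left V.mul_comm[of "bvec i"] mul_comm[of "e i"])
  qed
  have prod: "lin_comb e (mul' c d) = mul (lin_comb e c) (lin_comb e d)" for c d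
  proof -
    have "mul' c d = (\<Sum>i\<in>UNIV. c $ i *s mul' (bvec i) d)"
      by (subst expand[of c]) (simp add: V.mul_sum_left V.mul_scale_left)
    then have "lin_comb e (mul' c d) = (\<Sum>i\<in>UNIV. scale (c $ i) (mul (e i) (lin_comb e d)))"
      by (simp add: lin_comb_sum lin_comb_scale prod_right)
    then show ?thesis
      by (simp add: lin_comb_def[of e c] mul_sum_left mul_scale_left)
  qed
  have inj: "inj (lin_comb e)"
  proof (rule injI)
    fix c d assume "lin_comb e c = lin_comb e d"
    then have "(c - d) $ i = 0" for i
      by (intro indep) (simp add: lin_comb_diff)
    then show "c = d"
      by (simp add: vec_eq_iff)
  qed
  have "a \<in> range (lin_comb e)" for a
    using spanning[of a]
  proof (induction rule: span_induct_alt)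
    case base
    show ?case
      using lin_comb_0 by (metis rangeI)
  next
    case (step k a b)
    then obtain i d where "a = e i" "b = lin_comb e d"
      by blast
    then have "scale k a + b = lin_comb e (k *s bvec i + d)"
      by (simp add: lin_comb_simps)
    then show ?case
      by blast
  qed
  then have bij: "bij (lin_comb e)"
    using inj by (auto simp: bij_def)
  let ?f = "inv (lin_comb e)"
  have f_inv: "lin_comb e (?f a) = a" for a
    using bij by (simp add: bij_is_surj surj_f_inv_f)
  have f_eq: "?f a = c" if "lin_comb e c = a" for a c
    using inj that by (auto simp: inv_f_f)
  have "Vector_Spaces.linear scale (*s) ?f"
    unfolding Vector_Spaces.linear_iff
    by (intro conjI allI f_eq vector_space_axioms vec.vector_space_axioms) (simp_all add: lin_comb_simps f_inv)
  moreover have "?f (mul a b) = mul' (?f a) (?f b)" for a b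
    by (intro f_eq) (simp add: prod f_inv)
  ultimately show ?thesis
    using bij_imp_bij_inv[OF bij] unfolding algebra_isomorphic_def by blast
qed

end

lemma UNIV_basis3: "UNIV = {X3, Y3, Z3}"
  using basis3.exhaust by auto

lemma UNIV_basisQ: "UNIV = {S1, S2, D1, D2}"
  using basisQ.exhaust by auto

lemma UNIV_basisQx: "UNIV = {X4, Y4, Z4, One4}"
  using basisQx.exhaust by auto

lemma eq_times_inverse: "k * a = l \<Longrightarrow> k * h = 1 \<Longrightarrow> a = l * h" for a h k l :: "'f::field"
  by (metis mult.assoc mult.commute mult_1)

context axis_pair_table
begin

section \<open>Explicit bases for the listed algebras\<close>

lemma C_eq_0': "0 = C a b c d \<longleftrightarrow> a = 0 \<and> (x = 0 \<or> b = 0) \<and> (y = 0 \<or> c = 0) \<and> d = 0"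
  unfolding C_eq_0[symmetric] by (rule eq_commute)

lemma C_minus: "- C a b c d = C (- a) (- b) (- c) (- d)"
  by (simp add: C_def)

lemma spanning_if:
  assumes "C 1 0 0 0 \<in> span S" "C 0 1 0 0 \<in> span S" "C 0 0 1 0 \<in> span S" "C 0 0 0 1 \<in> span S"
  shows "e \<in> span S"
proof -
  obtain k1 k2 k3 k4 where "e = k1 \<cdot> p + k2 \<cdot> x + k3 \<cdot> y + k4 \<cdot> z"
    using p_expansion by blast
  then show ?thesis
    using assms by (simp add: p_C[symmetric] x_C[symmetric] y_C[symmetric] z_C[symmetric] span_add span_scale)
qed

lemma three_nz: "y \<noteq> 0 \<Longrightarrow> (3::'f) \<noteq> 0"
  using y_nz_case(1) by (metis mult_zero_left zero_neq_one)

text \<open>The element \<open>p + 6 \<cdot> x\<close> is the identity, so \<open>D1\<close> is \<open>1 - p\<close>.\<close>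
primrec basis_Q :: "basisQ \<Rightarrow> 'a" where
  "basis_Q S1 = C \<mu> 1 1 1"
| "basis_Q S2 = C \<mu> 1 1 (-1)"
| "basis_Q D1 = C 0 6 0 0"
| "basis_Q D2 = C (2 * \<mu>) 2 (-2) 0"

text \<open>\<open>S1\<close> is \<open>q\<close>, and \<open>S2\<close> is its image under the
  automorphism negating the \<beta>-part of \<open>p\<close>. Similarly
  \<open>D2 = D1 + 2 \<cdot> v\<close> is the image of \<open>D1\<close> under negating the
  \<alpha>-part of \<open>q\<close>.\<close>

lemma algebra_isomorphic_Q2:
  assumes y: "y \<noteq> 0" and five_nz: "(5::'f) \<noteq> 0"
  shows "algebra_isomorphic scale mul (*s) (Q2_mult :: 'f ^ basisQ \<Rightarrow> _)"
proof (rule algebra_isomorphic_if_basis[of _ basis_Q])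
  show "comm_algebra (*s) Q2_mult"
    by (rule comm_algebra_Q2)
  \<comment> \<open>All denominators divide powers of 6, so with \<open>6 * g = 1\<close> the checks
    become polynomial identities in \<open>g\<close>.\<close>
  define g :: 'f where "g = 1 / 6"
  have six_nz: "(6::'f) \<noteq> 0"
    using mult_eq_0_iff[of "2::'f" 3] two_nz three_nz[OF y] by simp
  then have g: "6 * g = 1"
    by (simp add: g_def)
  have fractions: "1 / 6 = g" "1 / 3 = 2 * g"
    using three_nz[OF y] six_nz by (simp_all add: g_def field_simps)
  note table = y_nz_case[OF y]
  have inverses: "2 * (3 * g) = 1" "3 * (2 * g) = 1" "9 * (4 * (g * g)) = 1" "12 * (3 * (g * g)) = 1"
    "18 * (2 * (g * g)) = 1" "24 * (9 * (g * g * g)) = 1" "144 * (9 * (g * g * g * g)) = 1"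
    using g by algebra+
  note vals = eq_times_inverse[OF table(1) inverses(2)] eq_times_inverse[OF table(2) inverses(2)]
    eq_times_inverse[OF table(3) inverses(4)] eq_times_inverse[OF table(4) g] eq_times_inverse[OF table(5) inverses(3)]
    eq_times_inverse[OF table(6) inverses(5)] eq_times_inverse[OF table(7) inverses(7)] eq_times_inverse[OF table(8) inverses(2)]
    eq_times_inverse[OF table(9) g] eq_times_inverse[OF table(10) inverses(6)] eq_times_inverse[OF table(11) inverses(1)]
    eq_times_inverse[OF table(12) inverses(1)]
  let ?P = "\<lambda>i j. lin_comb basis_Q (Q2_mult (bvec i) (bvec j)) = basis_Q i \<odot> basis_Q j"
  note to_coords = Q2_basis_products lin_comb_simps basis_Q.simps C_ops C_mul C_minus C_eq_iff C_eq_0' fractions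
  have products: "?P S1 S1" "?P S2 S2" "?P D1 D1" "?P D2 D2"
    "?P S1 S2" "?P S1 D1" "?P S2 D1" "?P S1 D2"
    "?P S2 D2" "?P D1 D2"
    unfolding to_coords unfolding vals by (intro conjI disjI2; (use g in algebra | simp))+
  show "?P i j \<or> ?P j i" for i j
    by (cases i; cases j) (simp_all only: products simp_thms)
  show "c $ i = 0" if "lin_comb basis_Q c = 0" for c i
  proof -
    have "C (\<mu> * (c $ S1 + c $ S2 + 2 * c $ D2)) (c $ S1 + c $ S2 + 6 * c $ D1 + 2 * c $ D2)
        (c $ S1 + c $ S2 - 2 * c $ D2) (c $ S1 - c $ S2) = 0"
      using that by (simp add: lin_comb_def UNIV_basisQ C_ops algebra_simps)
    then have e: "\<mu> * (c $ S1 + c $ S2 + 2 * c $ D2) = 0" "c $ S1 + c $ S2 + 6 * c $ D1 + 2 * c $ D2 = 0"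
        "c $ S1 + c $ S2 - 2 * c $ D2 = 0" "c $ S1 - c $ S2 = 0"
      using x_nz y by (auto simp: C_eq_0)
    \<comment> \<open>By the third equation, the coefficients of \<open>S1\<close> and
      \<open>S2\<close> add up to twice that of \<open>D2\<close>, and
      \<open>12 * \<mu> = 5\<close>.\<close>
    have "5 * (c $ D2) = 3 * (\<mu> * (c $ S1 + c $ S2 + 2 * c $ D2))"
      using e(3) table(3) by algebra
    then have d2: "c $ D2 = 0"
      using five_nz e(1) by simp
    have "2 * c $ S1 = 0"
      using e(3,4) d2 by algebra
    then have "c $ S1 = 0"
      by (rule two_cancel)
    then show ?thesis
      using e d2 six_nz by (cases i) auto
  qed
  show "a \<in> span (range basis_Q)" for a
  proof (rule spanning_if)
    have b: "basis_Q i \<in> span (range basis_Q)" for i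
      by (simp add: span_base)
    have "C 0 1 0 0 = g \<cdot> basis_Q D1"
      unfolding to_coords by (intro conjI disjI2; (use g in algebra | simp))
    also have "\<dots> \<in> span (range basis_Q)"
      by (intro span_scale b)
    finally show "C 0 1 0 0 \<in> span (range basis_Q)" .
    have "C 0 0 0 1 = (3 * g) \<cdot> (basis_Q S1 - basis_Q S2)"
      unfolding to_coords by (intro conjI disjI2; (use g in algebra | simp))
    also have "\<dots> \<in> span (range basis_Q)"
      by (intro span_scale span_diff b)
    finally show "C 0 0 0 1 \<in> span (range basis_Q)" .
    obtain h :: 'f where h: "5 * h = 1"
      using five_nz by (metis field_class.field_inverse mult.commute)
    \<comment> \<open>The sum of \<open>S1\<close>, \<open>S2\<close> and \<open>D2\<close> is
      \<open>C (4 * \<mu>) 4 0 0\<close>, and \<open>12 * \<mu> = 5\<close> is invertible with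
      inverse \<open>h\<close>.\<close>
    have "C 1 0 0 0 = (3 * h) \<cdot> (basis_Q S1 + basis_Q S2 + basis_Q D2) - (2 * h) \<cdot> basis_Q D1"
      unfolding to_coords unfolding vals by (intro conjI disjI2; (use g h in algebra | simp))
    also have "\<dots> \<in> span (range basis_Q)"
      by (intro span_scale span_diff span_add b)
    finally show p: "C 1 0 0 0 \<in> span (range basis_Q)" .
    have "C 0 0 1 0 = (3 * g) \<cdot> (basis_Q S1 + basis_Q S2) - g \<cdot> basis_Q D1 - \<mu> \<cdot> C 1 0 0 0"
      unfolding to_coords unfolding vals by (intro conjI disjI2; (use g in algebra | simp))
    also have "\<dots> \<in> span (range basis_Q)"
      by (intro span_scale span_diff span_add b p)
    finally show "C 0 0 1 0 \<in> span (range basis_Q)" .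
  qed
qed

text \<open>In characteristic 5, \<mu> vanishes and the vectors of \<open>basis_Q\<close> all lie in
  the span of \<open>x, y, z\<close>. The identity \<open>p + 6 \<cdot> x\<close> therefore replaces
  \<open>D2\<close>.\<close>

primrec basis_Qx :: "basisQx \<Rightarrow> 'a" where
  "basis_Qx X4 = C \<mu> 1 1 1"
| "basis_Qx Y4 = C \<mu> 1 1 (-1)"
| "basis_Qx Z4 = C 0 6 0 0"
| "basis_Qx One4 = C 1 6 0 0"

lemma algebra_isomorphic_Q2x:
  assumes y: "y \<noteq> 0" and five: "(5::'f) = 0"
  shows "algebra_isomorphic scale mul (*s) (Q2x_mult :: 'f ^ basisQx \<Rightarrow> _)"
proof (rule algebra_isomorphic_if_basis[of _ basis_Qx])
  show "comm_algebra (*s) Q2x_mult"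
    by (rule comm_algebra_Q2x)
  note table = y_nz_case[OF y]
  \<comment> \<open>Numerals are reduced modulo 5 to residues between -2 and 2.\<close>
  have
    "3 = 5 * 1 + (- 2::'f)" "4 = 5 * 1 + (- 1::'f)" "6 = 5 * 1 + (1::'f)"
    "7 = 5 * 1 + (2::'f)" "8 = 5 * 2 + (- 2::'f)" "9 = 5 * 2 + (- 1::'f)" "10 = 5 * 2 + (0::'f)"
    "12 = 5 * 2 + (2::'f)" "18 = 5 * 4 + (- 2::'f)" "24 = 5 * 5 + (- 1::'f)" "144 = 5 * 29 + (- 1::'f)"
    by simp_all
  note mod5 = this[unfolded five mult_zero_left add_0_left] five
  have inverses: "2 * (- 2::'f) = 1" "3 * (2::'f) = 1" "6 * (1::'f) = 1" "9 * (- 1::'f) = 1"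
    "12 * (- 2::'f) = 1" "18 * (2::'f) = 1" "24 * (- 1::'f) = 1" "144 * (- 1::'f) = 1"
    by (simp_all add: mod5)
  have vals: "\<alpha> = 2" "\<beta> = - 1" "\<mu> = 0" "r = 1" "s = - 1" "m = 2" "t1 = 0" "t2 = 2" "n = 1" "c1 = 0"
    "c2 = - 2" "c3 = - 2"
    using eq_times_inverse[OF table(1) inverses(2)] eq_times_inverse[OF table(2) inverses(2)]
      eq_times_inverse[OF table(3) inverses(5)] eq_times_inverse[OF table(4) inverses(3)] eq_times_inverse[OF table(5) inverses(4)]
      eq_times_inverse[OF table(6) inverses(6)] eq_times_inverse[OF table(7) inverses(8)] eq_times_inverse[OF table(8) inverses(2)]
      eq_times_inverse[OF table(9) inverses(3)] eq_times_inverse[OF table(10) inverses(7)] eq_times_inverse[OF table(11) inverses(1)]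
      eq_times_inverse[OF table(12) inverses(1)]
    by (simp_all add: mod5)
  let ?P = "\<lambda>i j. lin_comb basis_Qx (Q2x_mult (bvec i) (bvec j)) = basis_Qx i \<odot> basis_Qx j"
  note to_coords = Q2x_basis_products lin_comb_simps basis_Qx.simps C_ops C_mul C_minus C_eq_iff C_eq_0'
  have products: "?P X4 X4" "?P Y4 Y4" "?P Z4 Z4" "?P One4 One4"
    "?P One4 X4" "?P One4 Y4" "?P One4 Z4" "?P X4 Y4" "?P X4 Z4" "?P Y4 Z4"
    unfolding to_coords unfolding vals by (intro conjI disjI2; simp add: mod5)+
  show "?P i j \<or> ?P j i" for i j
    by (cases i; cases j) (simp_all only: products simp_thms)
  show "c $ i = 0" if "lin_comb basis_Qx c = 0" for c i
  proof -
    have "C (\<mu> * (c $ X4 + c $ Y4) + c $ One4) (c $ X4 + c $ Y4 + 6 * c $ Z4 + 6 * c $ One4)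
        (c $ X4 + c $ Y4) (c $ X4 - c $ Y4) = 0"
      using that by (simp add: lin_comb_def UNIV_basisQx C_ops algebra_simps)
    then have e: "\<mu> * (c $ X4 + c $ Y4) + c $ One4 = 0"
        "c $ X4 + c $ Y4 + 6 * c $ Z4 + 6 * c $ One4 = 0" "c $ X4 + c $ Y4 = 0" "c $ X4 - c $ Y4 = 0"
      using x_nz y by (auto simp: C_eq_0)
    have "2 * c $ X4 = 0"
      using e(3,4) by algebra
    then have "c $ X4 = 0"
      by (rule two_cancel)
    then show ?thesis
      using e mod5 by (cases i) auto
  qed
  show "a \<in> span (range basis_Qx)" for a
  proof (rule spanning_if)
    have b: "basis_Qx i \<in> span (range basis_Qx)" for i
      by (simp add: span_base)
    have "C 0 1 0 0 = 1 \<cdot> basis_Qx Z4"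
      unfolding to_coords by (intro conjI disjI2; simp add: mod5)
    also have "\<dots> \<in> span (range basis_Qx)"
      by (intro span_scale b)
    finally show "C 0 1 0 0 \<in> span (range basis_Qx)" .
    have "C 0 0 0 1 = 3 \<cdot> (basis_Qx X4 - basis_Qx Y4)"
      unfolding to_coords by (intro conjI disjI2; simp add: mod5)
    also have "\<dots> \<in> span (range basis_Qx)"
      by (intro span_scale span_diff b)
    finally show "C 0 0 0 1 \<in> span (range basis_Qx)" .
    have "C 1 0 0 0 = basis_Qx One4 - basis_Qx Z4"
      unfolding to_coords by (intro conjI disjI2; simp)
    also have "\<dots> \<in> span (range basis_Qx)"
      by (intro span_diff b)
    finally show "C 1 0 0 0 \<in> span (range basis_Qx)" .
    have "C 0 0 1 0 = 3 \<cdot> (basis_Qx X4 + basis_Qx Y4) - basis_Qx Z4"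
      unfolding to_coords unfolding vals by (intro conjI disjI2; simp add: mod5)
    also have "\<dots> \<in> span (range basis_Qx)"
      by (intro span_scale span_diff span_add b)
    finally show "C 0 0 1 0 \<in> span (range basis_Qx)" .
  qed
qed

text \<open>Because \<open>2 * r = \<alpha>\<close>, the vector
  \<open>(2 / \<alpha>) \<cdot> x\<close> is idempotent; it is joined by \<open>q\<close> and its
  mirror image under negating \<open>z\<close>. Independence needs \<open>\<mu> \<noteq> 0\<close>,
  that is \<open>\<alpha> \<noteq> - 1\<close>.\<close>

lemma algebra_isomorphic_threeC:
  assumes y: "y = 0" and "\<alpha> \<noteq> - 1"
  shows "algebra_isomorphic scale mul (*s) (threeC_mult \<alpha>)"
proof -
  note table = y_zero_case[OF y]
  obtain h l :: 'f where h: "2 * h = 1" and l: "\<alpha> * l = 1"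
    using two_nz \<alpha>_nz by (metis field_class.field_inverse mult.commute)
  have half: "a / 2 = a * h" for a
    using h two_nz by (simp add: field_simps)
  define e where "e = rec_basis3 (C 0 (2 * l) 0 0) (C \<mu> 1 0 1) (C \<mu> 1 0 (- 1))"
  have e_simps: "e X3 = C 0 (2 * l) 0 0" "e Y3 = C \<mu> 1 0 1" "e Z3 = C \<mu> 1 0 (- 1)"
    by (simp_all add: e_def)
  note to_coords = threeC_basis_products lin_comb_simps e_simps C_ops C_mul C_minus C_eq_iff C_eq_0' half
  let ?P = "\<lambda>i j. lin_comb e (threeC_mult \<alpha> (bvec i) (bvec j)) = e i \<odot> e j"
  have 4: "4 * (h * h) = 1"
    using h by algebra
  have "\<beta> = 1 - \<alpha>"
    using table(1) by algebra
  note vals = this table(2,3,4,6)[THEN eq_times_inverse, OF h] eq_times_inverse[OF table(5) 4]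
  show ?thesis
  proof (rule algebra_isomorphic_if_basis[of _ e])
    show "comm_algebra (*s) (threeC_mult \<alpha>)"
      by (rule comm_algebra_threeC)
    have products: "?P X3 X3" "?P Y3 Y3" "?P Z3 Z3" "?P X3 Y3" "?P X3 Z3" "?P Y3 Z3"
      unfolding to_coords unfolding vals
      by (intro conjI disjI1[OF y] disjI2; (use h l in algebra | simp add: y algebra_simps))+
    show "?P i j \<or> ?P j i" for i j
      by (cases i; cases j) (simp_all only: products simp_thms)
    show "c $ i = 0" if "lin_comb e c = 0" for c i
    proof -
      have "C (\<mu> * (c $ Y3 + c $ Z3)) (2 * l * c $ X3 + c $ Y3 + c $ Z3) 0 (c $ Y3 - c $ Z3) = 0"
        using that by (simp add: lin_comb_def UNIV_basis3 e_simps C_ops algebra_simps)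
      then have e: "\<mu> * (c $ Y3 + c $ Z3) = 0" "2 * l * c $ X3 + c $ Y3 + c $ Z3 = 0" "c $ Y3 - c $ Z3 = 0"
        using x_nz by (auto simp: C_eq_0)
      have "(1 + \<alpha>) * (c $ Y3 + c $ Z3) = 0"
        using e(1) table(2) by algebra
      then have *: "c $ Y3 + c $ Z3 = 0"
        using assms(2) by (auto simp: add_eq_0_iff)
      then have "2 * c $ Y3 = 0"
        using e(3) by algebra
      then have "c $ Y3 = 0"
        by (rule two_cancel)
      moreover have "2 * c $ X3 = 0"
        using e(2) * l by algebra
      then have "c $ X3 = 0"
        by (rule two_cancel)
      ultimately show ?thesis
        using e by (cases i) auto
    qed
    show "a \<in> span (range e)" for a
    proof (rule spanning_if)
      have b: "e i \<in> span (range e)" for i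
        by (simp add: span_base)
      have "C 0 1 0 0 = (\<alpha> * h) \<cdot> e X3"
        unfolding to_coords by (intro conjI disjI1[OF y] disjI2; (use h l in algebra | simp))
      also have "\<dots> \<in> span (range e)"
        by (intro span_scale b)
      finally show x: "C 0 1 0 0 \<in> span (range e)" .
      have "C 0 0 0 1 = h \<cdot> (e Y3 - e Z3)"
        unfolding to_coords by (intro conjI disjI1[OF y] disjI2; (use h l in algebra | simp))
      also have "\<dots> \<in> span (range e)"
        by (intro span_scale span_diff b)
      finally show "C 0 0 0 1 \<in> span (range e)" .
      obtain k :: 'f where k: "(1 + \<alpha>) * k = 1"
        using assms(2) by (metis field_class.field_inverse mult.commute add_eq_0_iff)
      have "C 1 0 0 0 = k \<cdot> (e Y3 + e Z3) - (2 * k) \<cdot> C 0 1 0 0"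
        unfolding to_coords unfolding vals
        by (intro conjI disjI1[OF y] disjI2; (use h k in algebra | simp))
      also have "\<dots> \<in> span (range e)"
        by (intro span_scale span_diff span_add b x)
      finally show "C 1 0 0 0 \<in> span (range e)" .
      have "C 0 0 1 0 = 0"
        unfolding C_eq_0 using y by simp
      then show "C 0 0 1 0 \<in> span (range e)"
        by (simp add: span_zero)
    qed
  qed
qed

text \<open>Here \<open>\<mu> = 0\<close> and the identity is \<open>p - 2 \<cdot> x\<close>. The
  basis consists of \<open>p\<close>, the identity minus \<open>q\<close>, and the mirror image of
  the latter under negating \<open>z\<close>.\<close>

lemma algebra_isomorphic_threeC_2:
  assumes y: "y = 0" and \<alpha>: "\<alpha> = - 1"
  shows "algebra_isomorphic scale mul (*s) (threeC_mult (2::'f))"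
proof -
  note table = y_zero_case[OF y]
  have \<beta>: "\<beta> = 2"
    using table(1) \<alpha> by (simp add: algebra_simps)
  \<comment> \<open>Characteristic 3 is excluded because \<alpha> and \<beta> differ.\<close>
  then have "3 = \<beta> - \<alpha>"
    using \<alpha> by simp
  then have three_nz: "(3::'f) \<noteq> 0"
    using \<alpha>_n\<beta> by (metis right_minus_eq)
  obtain h l :: 'f where h: "2 * h = 1" and l: "3 * l = 1"
    using two_nz three_nz by (metis field_class.field_inverse mult.commute)
  have half: "a / 2 = a * h" for a
    using h two_nz by (simp add: field_simps)
  define e where "e = rec_basis3 (C 1 0 0 0) (C 1 (- 3) 0 (- 1)) (C 1 (- 3) 0 1)"
  have e_simps: "e X3 = C 1 0 0 0" "e Y3 = C 1 (- 3) 0 (- 1)" "e Z3 = C 1 (- 3) 0 1"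
    by (simp_all add: e_def)
  note to_coords = threeC_basis_products lin_comb_simps e_simps C_ops C_mul C_minus C_eq_iff C_eq_0' half
  let ?P = "\<lambda>i j. lin_comb e (threeC_mult 2 (bvec i) (bvec j)) = e i \<odot> e j"
  have "4 * (h * h) = 1"
    using h by algebra
  then have vals: "r = - h" "m = h" "c1 = 0" "c2 = 3 * h"
    using table(3,4,6)[THEN eq_times_inverse, OF h] eq_times_inverse[OF table(5), of "h * h"] \<alpha>
    by simp_all
  show ?thesis
  proof (rule algebra_isomorphic_if_basis[of _ e])
    show "comm_algebra (*s) (threeC_mult (2::'f))"
      by (rule comm_algebra_threeC)
    have products: "?P X3 X3" "?P Y3 Y3" "?P Z3 Z3" "?P X3 Y3" "?P X3 Z3" "?P Y3 Z3"
      unfolding to_coords unfolding vals \<beta>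
      by (intro conjI disjI1[OF y] disjI2; (use h in algebra | simp add: y algebra_simps))+
    show "?P i j \<or> ?P j i" for i j
      by (cases i; cases j) (simp_all only: products simp_thms)
    show "c $ i = 0" if "lin_comb e c = 0" for c i
    proof -
      have "C (c $ X3 + c $ Y3 + c $ Z3) (3 * (- c $ Y3 - c $ Z3)) 0 (c $ Z3 - c $ Y3) = 0"
        using that by (simp add: lin_comb_def UNIV_basis3 e_simps C_ops algebra_simps)
      then have e: "c $ X3 + c $ Y3 + c $ Z3 = 0" "- c $ Y3 - c $ Z3 = 0" "c $ Z3 - c $ Y3 = 0"
        unfolding C_eq_0 mult_eq_0_iff using x_nz three_nz by blast+
      then have "2 * c $ Y3 = 0"
        by algebra
      then have "c $ Y3 = 0"
        by (rule two_cancel)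
      then show ?thesis
        using e by (cases i) auto
    qed
    show "a \<in> span (range e)" for a
    proof (rule spanning_if)
      have b: "e i \<in> span (range e)" for i
        by (simp add: span_base)
      show p: "C 1 0 0 0 \<in> span (range e)"
        using b[of X3] by (simp only: e_simps)
      have "C 0 0 0 1 = h \<cdot> (e Z3 - e Y3)"
        unfolding to_coords by (intro conjI disjI1[OF y] disjI2; (use h in algebra | simp))
      also have "\<dots> \<in> span (range e)"
        by (intro span_scale span_diff b)
      finally show "C 0 0 0 1 \<in> span (range e)" .
      have "C 0 1 0 0 = l \<cdot> (C 1 0 0 0 - h \<cdot> (e Y3 + e Z3))"
        unfolding to_coords by (intro conjI disjI1[OF y] disjI2; (use h l in algebra | simp))
      also have "\<dots> \<in> span (range e)"
        by (intro span_scale span_diff span_add b p)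
      finally show "C 0 1 0 0 \<in> span (range e)" .
      have "C 0 0 1 0 = 0"
        unfolding C_eq_0 using y by simp
      then show "C 0 0 1 0 \<in> span (range e)"
        by (simp add: span_zero)
    qed
  qed
qed

end

section \<open>Existence of the table and the final case distinction\<close>

lemma (in axis_pair) exists_table:
  assumes "z \<noteq> 0"
  obtains r s t1 t2 m n c1 c2 c3 a1 b1 a2 b2 a3 b3 h1 h2 where
    "axis_pair_table scale mul \<alpha> \<beta> p q \<mu> \<kappa> x y z u v r s t1 t2 m n c1 c2 c3 a1 b1 a2 b2 a3 b3 h1 h2"
proof -
  obtain r where xx: "x \<odot> x = r \<cdot> x"
    using zero_space_p M_facts(2)[OF px px] by blast
  obtain s where xy: "x \<odot> y = s \<cdot> y"
    using \<alpha>_space_p M_facts(3)[OF px py] by blast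
  obtain m where xz: "x \<odot> z = m \<cdot> z"
    using \<beta>_space_p M_facts(4)[OF px pz] by blast
  obtain n where yz: "y \<odot> z = n \<cdot> z"
    using \<beta>_space_p M_facts(6)[OF py pz] by blast
  obtain t1 t2 where yy: "y \<odot> y = t1 \<cdot> p + t2 \<cdot> x"
    using zero_space_p M_facts(5)[OF py py] by blast
  obtain c1 c2 c3 where zz: "z \<odot> z = c1 \<cdot> p + c2 \<cdot> x + c3 \<cdot> y"
    using zero_space_p \<alpha>_space_p M_facts(7)[OF pz pz] by blast
  obtain a1 b1 where qx: "q \<odot> x = a1 \<cdot> q + b1 \<cdot> (q \<odot> p)"
    using q_mul by blast
  obtain a2 b2 where qy: "q \<odot> y = a2 \<cdot> q + b2 \<cdot> (q \<odot> p)"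
    using q_mul by blast
  obtain a3 b3 where qz: "q \<odot> z = a3 \<cdot> q + b3 \<cdot> (q \<odot> p)"
    using q_mul by blast
  have "q \<odot> (x - a1 \<cdot> q - b1 \<cdot> p) = 0" "q \<odot> (y - a2 \<cdot> q - b2 \<cdot> p) = 0"
    by (simp_all add: bilinear_simps qq qx qy)
  then obtain h1 h2 where "(x - a1 \<cdot> q - b1 \<cdot> p) \<odot> v = h1 \<cdot> v" "(y - a2 \<cdot> q - b2 \<cdot> p) \<odot> v = h2 \<cdot> v"
    using zero_space_q_mul_v by blast
  then have "axis_pair_table scale mul \<alpha> \<beta> p q \<mu> \<kappa> x y z u v r s t1 t2 m n c1 c2 c3 a1 b1 a2 b2 a3 b3 h1 h2"
    by unfold_locales (use assms xx xy xz yy yz zz qx qy qz in blast)+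
  then show thesis
    by (rule that)
qed

theorem corollary1p2:
  fixes scale :: "'f::field \<Rightarrow> 'a::ab_group_add \<Rightarrow> 'a"
    and mul :: "'a \<Rightarrow> 'a \<Rightarrow> 'a"
    and \<alpha> \<beta> :: 'f
    and p q :: 'a
  assumes "CHAR('f) \<noteq> 2"
    and "comm_algebra scale mul"
    and "\<alpha> \<notin> {0, 1}" and "\<beta> \<notin> {0, 1}" and "\<alpha> \<noteq> \<beta>"
    and "p \<noteq> q"
    and "comm_algebra.primitive_axis scale mul (M_law \<alpha> \<beta>) p"
    and "comm_algebra.primitive_axis scale mul (J_law \<alpha>) q"
    and "comm_algebra.generates scale mul {p, q}"
  shows "comm_algebra.axial_algebra_of_J_type scale mul \<alpha> \<or>
    (\<alpha> \<noteq> 1/2 \<and> \<alpha> + \<beta> = 1 \<and>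
       algebra_isomorphic scale mul (*s) (threeC_M_mult \<alpha>)) \<or>
    (\<alpha> = 1/3 \<and> \<beta> = 2/3 \<and> CHAR('f) \<noteq> 5 \<and>
       algebra_isomorphic scale mul (*s) (Q2_mult :: 'f ^ basisQ \<Rightarrow> _)) \<or>
    (\<alpha> = 1/3 \<and> \<beta> = 2/3 \<and> CHAR('f) = 5 \<and>
       algebra_isomorphic scale mul (*s) (Q2x_mult :: 'f ^ basisQx \<Rightarrow> _))"
proof -
  interpret comm_algebra scale mul
    by fact
  have two_nz: "(2::'f) \<noteq> 0"
  proof
    assume "(2::'f) = 0"
    then have "CHAR('f) dvd 2"
      using of_nat_eq_0_iff_char_dvd[of 2, where 'a = 'f] by simp
    then have "CHAR('f) \<noteq> 0" "CHAR('f) \<le> 2"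
      using dvd_imp_le[of "CHAR('f)" 2] dvd_pos_nat[of 2 "CHAR('f)"] by auto
    then show False
      using assms(1) CHAR_not_1[where 'a = 'f] by arith
  qed
  have five: "(5::'f) = 0 \<longleftrightarrow> CHAR('f) = 5"
  proof -
    have "CHAR('f) dvd 5 \<longleftrightarrow> CHAR('f) = 5"
    proof
      assume *: "CHAR('f) dvd 5"
      then have "CHAR('f) \<noteq> 0" "CHAR('f) \<le> 5"
        using dvd_imp_le[of "CHAR('f)" 5] dvd_pos_nat[of 5 "CHAR('f)"] by auto
      then have "CHAR('f) \<in> {2, 3, 4, 5}"
        using CHAR_not_1[where 'a = 'f] unfolding insert_iff empty_iff by arith
      then show "CHAR('f) = 5"
        using * by auto
    qed simp
    then show ?thesis
      using of_nat_eq_0_iff_char_dvd[of 5, where 'a = 'f] by simp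
  qed
  obtain \<mu> x y z where q: "q = scale \<mu> p + x + y + z" "mul p x = 0" "mul p y = scale \<alpha> y"
      "mul p z = scale \<beta> z"
    using M_axis_facts(2)[OF assms(3-5,7), of q] by blast
  obtain \<kappa> u v where p: "p = scale \<kappa> q + u + v" "mul q u = 0" "mul q v = scale \<alpha> v"
    using J_axis_facts(2)[OF assms(3,8), of p] by blast
  interpret axis_pair scale mul \<alpha> \<beta> p q \<mu> \<kappa> x y z u v
    by unfold_locales (use assms two_nz q p in blast)+
  show ?thesis
  proof (cases "z = 0")
    case True
    then have "primitive_axial_algebra (J_law \<alpha>)"
      unfolding primitive_axial_algebra_def
      using J_axis_if_no_\<beta>_part assms(6,8,9) by (intro exI[of _ "{p, q}"]) auto
    then show ?thesis
      using assms(3) by (simp add: axial_algebra_of_J_type_def)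
  next
    case False
    then obtain r s t1 t2 m n c1 c2 c3 a1 b1 a2 b2 a3 b3 h1 h2 where
      "axis_pair_table scale mul \<alpha> \<beta> p q \<mu> \<kappa> x y z u v r s t1 t2 m n c1 c2 c3 a1 b1 a2 b2 a3 b3 h1 h2"
      by (rule exists_table)
    then interpret axis_pair_table scale mul \<alpha> \<beta> p q \<mu> \<kappa> x y z u v
      r s t1 t2 m n c1 c2 c3 a1 b1 a2 b2 a3 b3 h1 h2 .
    show ?thesis
    proof (cases "y = 0")
      case True
      note ab = y_zero_case(1)[OF True]
      have "\<alpha> \<noteq> 1 / 2"
      proof
        assume "\<alpha> = 1 / 2"
        then have "2 * \<alpha> = 1"
          using two_nz by (simp add: mult.commute)
        \<comment> \<open>Together with \<open>\<alpha> + \<beta> = 1\<close>, the value 1/2 would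
          make \<alpha> and \<beta> equal.\<close>
        then have "\<alpha> + \<alpha> = \<alpha> + \<beta>"
          by (simp only: ab flip: mult_2)
        then show False
          using assms(5) by simp
      qed
      then show ?thesis
        using ab algebra_isomorphic_threeC[OF True] algebra_isomorphic_threeC_2[OF True]
        by (simp add: threeC_M_mult_def)
    next
      case False
      note ab = y_nz_case(1,2)[OF False]
      then have "\<alpha> = 1 / 3" "\<beta> = 2 / 3"
        using three_nz[OF False] by (simp_all add: eq_divide_eq mult.commute)
      then show ?thesis
        using five algebra_isomorphic_Q2[OF False] algebra_isomorphic_Q2x[OF False] by blast
    qed
  qed
qed

end
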